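(* Consider the two-matrix model potentials $W(x,y)$ listed below, with corresponding resolved geometries $\widehat{\mathcal{M}}$ $$\beta=1/\gamma,\qquad v_1=\gamma^{-1}w_1,\qquad v_2=\gamma^{3}w_2+\partial_{w_1}E(\gamma,w_1),$$ given by the listed perturbation terms $\partial_{w_1}E(\gamma,w_1)$. Blowing down the exceptional $\mathbb{P}^1$ in each $\widehat{\mathcal{M}}$ yields the following singular geometries $\mathcal{M}_0$: 1. ($A_k$) $W=\frac{1}{k+1}x^{k+1}+\frac12y^2$, $\ \partial_{w_1}E=\gamma^2w_1^k+w_1$: $$\mathcal{M}_0:\ XY-T(Z^k-T)=0.$$ 2. ($D_{k+2}$) $W=\frac{1}{k+1}x^{k+1}+xy^2$, $\ \partial_{w_1}E=\gamma^2w_1^k+w_1^2$: $$\mathcal{M}_0:\ X^2-Y^2Z+T(Z^{k/2}-T)^2=0\quad (k \text{ even}),$$ $$\mathcal{M}_0:\ X^2-Y^2Z-T(Z^k-T^2)=0\quad (k\text{ odd}).$$ 3. ($E_7$) $W=\frac13y^3+yx^3$, $\ \partial_{w_1}E=\gamma^{-1}w_1^2+\gamma w_1^3$: $$\mathcal{M}_0:\ X^2-Y^3+Z^5+3TYZ^2+T^3Z=0.$$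
   Context: $\widehat{\mathcal{M}}$ is the threefold glued from two coordinate patches $(\gamma,w_1,w_2)$ and $(\beta,v_1,v_2)$ by the given transition functions; $\gamma,\beta$ are stereographic coordinates on the exceptional $\mathbb{P}^1$, which is located at $w_1=w_2=0$, $v_1=v_2=0$. $E(\gamma,w)$ is the geometric potential, and $W(x,y)=\frac{1}{2\pi i}\oint\gamma^{-3}E(\gamma,x+\gamma y)\,d\gamma$ (integral over a small loop around $0$), i.e. the coefficient of $\gamma^2$ in $E(\gamma,x+\gamma y)$. $k$ is the index appearing in the names $A_k$, $D_{k+2}$; no further restriction on it is stated. $\mathcal{M}_0$ is a hypersurface in $\mathbb{C}^4$ with coordinates $X,Y,Z,T$. Blowing down: a global holomorphic function on $\widehat{\mathcal{M}}$ is a polynomial in $\beta,v_1,v_2$ which under the transition functions is also a polynomial in $\gamma,w_1,w_2$; it is constant on the exceptional $\mathbb{P}^1$. The blow-down map $\pi:\widehat{\mathcal{M}}\to\mathcal{M}_0$ is given by a collection of global holomorphic functions that collapses the exceptional $\mathbb{P}^1$ to a point and is a birational isomorphism elsewhere; the equation of $\mathcal{M}_0$ is the relation satisfied by these functions. *)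

theory Defs
  imports "HOL-Complex_Analysis.Complex_Analysis"
begin

type_synonym cpx3 = "complex \<times> complex \<times> complex"
type_synonym cpx4 = "complex \<times> complex \<times> complex \<times> complex"

text \<open>Polynomial functions in a given set of coordinate functions. Over the infinite field of
  complex numbers these are the same thing as polynomials.\<close>

inductive poly_in :: "('a \<Rightarrow> complex) set \<Rightarrow> ('a \<Rightarrow> complex) \<Rightarrow> bool"
  for C :: "('a \<Rightarrow> complex) set" where
  coord: "c \<in> C \<Longrightarrow> poly_in C c"
| const: "poly_in C (\<lambda>_. a)"
| add: "poly_in C f \<Longrightarrow> poly_in C g \<Longrightarrow> poly_in C (\<lambda>x. f x + g x)"
| mult: "poly_in C f \<Longrightarrow> poly_in C g \<Longrightarrow> poly_in C (\<lambda>x. f x * g x)"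

definition coords3 :: "(cpx3 \<Rightarrow> complex) set" where
  "coords3 = {(\<lambda>(x, y, z). x), (\<lambda>(x, y, z). y), (\<lambda>(x, y, z). z)}"

definition coords4 :: "(cpx4 \<Rightarrow> complex) set" where
  "coords4 = {(\<lambda>(x, y, z, t). x), (\<lambda>(x, y, z, t). y), (\<lambda>(x, y, z, t). z), (\<lambda>(x, y, z, t). t)}"

definition zariski_open :: "('a \<Rightarrow> complex) set \<Rightarrow> 'a set \<Rightarrow> bool" where
  "zariski_open C U \<longleftrightarrow> (\<exists>S. (\<forall>f\<in>S. poly_in C f) \<and> U = {x. \<exists>f\<in>S. f x \<noteq> 0})"


subsection \<open>Geometric and matrix model potentials\<close>

text \<open>A geometric potential \<open>E(\<gamma>, w)\<close> is only meaningful for \<open>\<gamma> \<noteq> 0\<close> (it may have a pole at \<open>\<gamma> = 0\<close>).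
  It is determined by \<open>\<partial>E/\<partial>w\<close> up to a function of \<open>\<gamma>\<close> alone, which does not enter the geometry and
  changes the matrix model potential by an additive constant; the normalisation
  \<open>E(\<gamma>, 0) = 0\<close> fixes it.\<close>

definition geometric_potential ::
  "(complex \<Rightarrow> complex \<Rightarrow> complex) \<Rightarrow> (complex \<Rightarrow> complex \<Rightarrow> complex) \<Rightarrow> bool" where
  "geometric_potential E dE \<longleftrightarrow>
     (\<forall>\<gamma>. \<gamma> \<noteq> 0 \<longrightarrow> E \<gamma> 0 = 0 \<and> (\<forall>w. (E \<gamma> has_field_derivative dE \<gamma> w) (at w)))"

text \<open>\<open>residue\<close> is by definition \<open>1 / (2 \<pi> i)\<close> times the contour integral over every
  sufficiently small circle.\<close>

definition matrix_potential ::
  "(complex \<Rightarrow> complex \<Rightarrow> complex) \<Rightarrow> complex \<Rightarrow> complex \<Rightarrow> complex" where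
  "matrix_potential E x y = residue (\<lambda>\<gamma>. \<gamma> powi (-3) * E \<gamma> (x + \<gamma> * y)) 0"


subsection \<open>The resolved geometry\<close>

datatype patch_point =
    GPatch complex complex complex  \<comment> \<open>\<open>\<gamma>, w\<^sub>1, w\<^sub>2\<close>\<close>
  | BPatch complex complex complex  \<comment> \<open>\<open>\<beta>, v\<^sub>1, v\<^sub>2\<close>\<close>

definition transition ::
  "(complex \<Rightarrow> complex \<Rightarrow> complex) \<Rightarrow> (patch_point \<times> patch_point) set" where
  "transition E =
     {(GPatch \<gamma> w1 w2, BPatch (1 / \<gamma>) (w1 / \<gamma>) (\<gamma> ^ 3 * w2 + deriv (E \<gamma>) w1)) | \<gamma> w1 w2. \<gamma> \<noteq> 0}"

definition glue :: "(complex \<Rightarrow> complex \<Rightarrow> complex) \<Rightarrow> (patch_point \<times> patch_point) set" where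
  "glue E = Id \<union> transition E \<union> (transition E)\<inverse>"

lemma equiv_glue: "equiv UNIV (glue E)"
proof (rule equivI)
  show "refl (glue E)" by (auto simp: glue_def refl_on_def)
  show "sym (glue E)" by (auto simp: glue_def sym_def)
  have inj: "p = p'" if "(p, q) \<in> transition E" "(p', q) \<in> transition E" for p p' q
    using that by (auto simp: transition_def)
  have fn: "q = q'" if "(p, q) \<in> transition E" "(p, q') \<in> transition E" for p q q'
    using that by (auto simp: transition_def)
  have no: "False" if "(p, q) \<in> transition E" "(q, r) \<in> transition E" for p q r
    using that by (auto simp: transition_def)
  show "trans (glue E)"
    unfolding glue_def by (rule transI) (use inj fn no in blast)
qed auto

definition threefold :: "(complex \<Rightarrow> complex \<Rightarrow> complex) \<Rightarrow> patch_point set set" where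
  "threefold E = UNIV // glue E"

definition gpt :: "(complex \<Rightarrow> complex \<Rightarrow> complex) \<Rightarrow> cpx3 \<Rightarrow> patch_point set" where
  "gpt E = (\<lambda>(\<gamma>, w1, w2). glue E `` {GPatch \<gamma> w1 w2})"

definition bpt :: "(complex \<Rightarrow> complex \<Rightarrow> complex) \<Rightarrow> cpx3 \<Rightarrow> patch_point set" where
  "bpt E = (\<lambda>(\<beta>, v1, v2). glue E `` {BPatch \<beta> v1 v2})"

definition exceptional_P1 :: "(complex \<Rightarrow> complex \<Rightarrow> complex) \<Rightarrow> patch_point set set" where
  "exceptional_P1 E = range (\<lambda>\<gamma>. gpt E (\<gamma>, 0, 0)) \<union> range (\<lambda>\<beta>. bpt E (\<beta>, 0, 0))"

definition global_fn ::
  "(complex \<Rightarrow> complex \<Rightarrow> complex) \<Rightarrow> (patch_point set \<Rightarrow> complex) \<Rightarrow> bool" where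
  "global_fn E f \<longleftrightarrow> poly_in coords3 (f \<circ> bpt E) \<and> poly_in coords3 (f \<circ> gpt E)"

definition threefold_open ::
  "(complex \<Rightarrow> complex \<Rightarrow> complex) \<Rightarrow> patch_point set set \<Rightarrow> bool" where
  "threefold_open E U \<longleftrightarrow> U \<subseteq> threefold E \<and>
     zariski_open coords3 (gpt E -` U) \<and> zariski_open coords3 (bpt E -` U)"


subsection \<open>Hypersurfaces in four-space\<close>

definition hypersurface :: "(cpx4 \<Rightarrow> complex) \<Rightarrow> cpx4 set" where
  "hypersurface F = {q. F q = 0}"

definition hypersurface_open :: "(cpx4 \<Rightarrow> complex) \<Rightarrow> cpx4 set \<Rightarrow> bool" where
  "hypersurface_open F V \<longleftrightarrow> (\<exists>O'. zariski_open coords4 O' \<and> V = hypersurface F \<inter> O')"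

definition singular_point :: "(cpx4 \<Rightarrow> complex) \<Rightarrow> cpx4 \<Rightarrow> bool" where
  "singular_point F = (\<lambda>(x, y, z, t). F (x, y, z, t) = 0 \<and>
     deriv (\<lambda>u. F (u, y, z, t)) x = 0 \<and> deriv (\<lambda>u. F (x, u, z, t)) y = 0 \<and>
     deriv (\<lambda>u. F (x, y, u, t)) z = 0 \<and> deriv (\<lambda>u. F (x, y, z, u)) t = 0)"


subsection \<open>Birational isomorphisms and blowing down\<close>

definition dense_wrt :: "('a set \<Rightarrow> bool) \<Rightarrow> 'a set \<Rightarrow> bool" where
  "dense_wrt opn U \<longleftrightarrow> (\<forall>O'. opn O' \<and> O' \<noteq> {} \<longrightarrow> O' \<inter> U \<noteq> {})"

text \<open>A map from a subset of four-space to the threefold is regular if locally it lands in one of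
  the two patches and has coordinates there given by quotients of polynomials.\<close>

definition regular_to_threefold ::
  "(complex \<Rightarrow> complex \<Rightarrow> complex) \<Rightarrow> cpx4 set \<Rightarrow> (cpx4 \<Rightarrow> patch_point set) \<Rightarrow> bool" where
  "regular_to_threefold E V \<psi> \<longleftrightarrow>
     (\<forall>q\<in>V. \<exists>N a b c d. zariski_open coords4 N \<and> q \<in> N \<and>
        poly_in coords4 a \<and> poly_in coords4 b \<and> poly_in coords4 c \<and> poly_in coords4 d \<and>
        (\<forall>r\<in>V \<inter> N. d r \<noteq> 0) \<and>
        ((\<forall>r\<in>V \<inter> N. \<psi> r = gpt E (a r / d r, b r / d r, c r / d r)) \<or>
         (\<forall>r\<in>V \<inter> N. \<psi> r = bpt E (a r / d r, b r / d r, c r / d r))))"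

text \<open>The map \<open>\<pi>\<close> is a birational isomorphism from the open subset \<open>A\<close> of the threefold to the
  open subset \<open>B\<close> of the hypersurface: it restricts to a biregular map between dense open subsets.
  No regularity is demanded of \<open>\<pi>\<close> itself, since below its components are global functions.\<close>

definition birational_iso ::
  "(complex \<Rightarrow> complex \<Rightarrow> complex) \<Rightarrow> (cpx4 \<Rightarrow> complex) \<Rightarrow> (patch_point set \<Rightarrow> cpx4) \<Rightarrow>
   patch_point set set \<Rightarrow> cpx4 set \<Rightarrow> bool" where
  "birational_iso E F \<pi> A B \<longleftrightarrow> \<pi> ` A \<subseteq> B \<and>
     (\<exists>U V \<psi>. U \<subseteq> A \<and> threefold_open E U \<and> dense_wrt (threefold_open E) U \<and>
        V \<subseteq> B \<and> hypersurface_open F V \<and> dense_wrt (hypersurface_open F) V \<and>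
        regular_to_threefold E V \<psi> \<and>
        (\<forall>p\<in>U. \<pi> p \<in> V \<and> \<psi> (\<pi> p) = p) \<and> (\<forall>q\<in>V. \<psi> q \<in> U \<and> \<pi> (\<psi> q) = q))"

text \<open>In \<open>blows_down_to\<close> the last conjunct says that the ideal of all polynomial relations
  satisfied by the four global functions is generated by \<open>F\<close>.\<close>

definition blows_down_to ::
  "(complex \<Rightarrow> complex \<Rightarrow> complex) \<Rightarrow> (cpx4 \<Rightarrow> complex) \<Rightarrow> bool" where
  "blows_down_to E F \<longleftrightarrow>
     (\<exists>\<pi> q0. (\<forall>c\<in>coords4. global_fn E (c \<circ> \<pi>)) \<and>
        \<pi> ` exceptional_P1 E = {q0} \<and> singular_point F q0 \<and>
        birational_iso E F \<pi> (threefold E - exceptional_P1 E) (hypersurface F - {q0}) \<and>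
        (\<forall>G. poly_in coords4 G \<longrightarrow>
           (\<forall>p\<in>threefold E. G (\<pi> p) = 0) \<longleftrightarrow> (\<exists>H. poly_in coords4 H \<and> (\<forall>q. G q = H q * F q))))"

end

theory Submission
  imports Defs
begin

text \<open>In each case four global functions are written down in the \<open>\<beta>\<close>-patch, their images in the
  \<open>\<gamma>\<close>-patch being polynomial because suitable differences vanish to sufficient order at
  \<open>\<gamma> = 0\<close>. Solving for \<open>\<beta>, v\<^sub>1, v\<^sub>2\<close> (each of them appears linearly once the other global
  functions are treated as coefficients) gives a rational inverse with a single denominator \<open>h\<close>,
  so \<open>h \<noteq> 0\<close> on the hypersurface is isomorphic to an open subset of the \<open>\<beta>\<close>-patch. The
  equation \<open>F\<close> is monic and quadratic in one variable; dividing a relation by \<open>F\<close> leaves a linear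
  remainder with two roots over a generic point, which is therefore zero. This gives the ideal of
  relations, and with it the density of \<open>h \<noteq> 0\<close> on the hypersurface.\<close>

section \<open>Polynomial functions\<close>

lemmas poly_in_intros = poly_in.const poly_in.add poly_in.mult

lemma poly_in_uminus: "poly_in C f \<Longrightarrow> poly_in C (\<lambda>x. - f x)"
  using poly_in.mult[OF poly_in.const[of C "-1"]] by simp

lemma poly_in_diff: "poly_in C f \<Longrightarrow> poly_in C g \<Longrightarrow> poly_in C (\<lambda>x. f x - g x)"
  using poly_in.add[OF _ poly_in_uminus] by fastforce

lemma poly_in_power: "poly_in C f \<Longrightarrow> poly_in C (\<lambda>x. f x ^ n)"
  by (induction n) (simp_all add: poly_in_intros)

lemma poly_in_mono: "poly_in C f \<Longrightarrow> C \<subseteq> D \<Longrightarrow> poly_in D f"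
  by (induction rule: poly_in.induct) (auto intro: poly_in.intros)

lemma poly_in_compose:
  assumes "poly_in C g" and "\<And>c. c \<in> C \<Longrightarrow> poly_in D (c \<circ> f)"
  shows "poly_in D (\<lambda>x. g (f x))"
  using assms by (induction rule: poly_in.induct) (auto intro: poly_in.intros simp: o_def)

text \<open>Applied to polynomials in a subset of the coordinates: changing only an omitted
  coordinate leaves their values fixed.\<close>

lemma poly_in_cong_on:
  assumes "poly_in C f" and "\<And>c. c \<in> C \<Longrightarrow> c p = c q"
  shows "f p = f q"
  using assms by (induction rule: poly_in.induct) auto

lemma coords3_iff: "c \<in> coords3 \<longleftrightarrow> c = fst \<or> c = (\<lambda>q. fst (snd q)) \<or> c = (\<lambda>q. snd (snd q))"
  by (auto simp: coords3_def case_prod_unfold)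

lemma coords4_iff:
  "c \<in> coords4 \<longleftrightarrow> c = fst \<or> c = (\<lambda>q. fst (snd q)) \<or> c = (\<lambda>q. fst (snd (snd q)))
     \<or> c = (\<lambda>q. snd (snd (snd q)))"
  by (auto simp: coords4_def case_prod_unfold)

lemma poly_in_coords3:
  "poly_in coords3 fst" "poly_in coords3 (\<lambda>q. fst q)"
  "poly_in coords3 (\<lambda>q. fst (snd q))" "poly_in coords3 (\<lambda>q. snd (snd q))"
  by (auto intro!: poly_in.coord simp: coords3_iff)

lemma poly_in_coords4:
  "poly_in coords4 fst" "poly_in coords4 (\<lambda>q. fst q)" "poly_in coords4 (\<lambda>q. fst (snd q))"
  "poly_in coords4 (\<lambda>q. fst (snd (snd q)))" "poly_in coords4 (\<lambda>q. snd (snd (snd q)))"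
  by (auto intro!: poly_in.coord simp: coords4_iff)

lemmas poly_in_rules =
  poly_in_intros poly_in_uminus poly_in_diff poly_in_power poly_in_coords3 poly_in_coords4

text \<open>Replacing \<open>n\<close> by \<open>Suc n\<close> turns the quotient \<open>p\<close>
  into \<open>f^n + (f + d) * p\<close>. With \<open>d\<close> divisible by
  \<open>\<gamma>^2\<close> this splits a power of \<open>v2\<close> in the \<gamma>-patch so that a
  factor \<open>1 / \<gamma>\<close> can be cancelled.\<close>

lemma poly_in_power_expand:
  assumes "poly_in C f" "poly_in C d"
  obtains p where "poly_in C p" "\<And>x. (f x + d x) ^ n = f x ^ n + d x * p x"
proof -
  have "\<exists>p. poly_in C p \<and> (\<forall>x. (f x + d x) ^ n = f x ^ n + d x * p x)"
  proof (induction n)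
    case 0
    show ?case by (intro exI[of _ "\<lambda>_. 0"]) (simp add: poly_in.const)
  next
    case (Suc n)
    then obtain p where p: "poly_in C p" "\<And>x. (f x + d x) ^ n = f x ^ n + d x * p x" by blast
    show ?case
    proof (intro exI conjI allI)
      show "poly_in C (\<lambda>x. f x ^ n + (f x + d x) * p x)"
        by (intro poly_in_rules assms p)
      show "(f x + d x) ^ Suc n = f x ^ Suc n + d x * (f x ^ n + (f x + d x) * p x)" for x
        unfolding power_Suc p(2) by algebra
    qed
  qed
  then show ?thesis using that by blast
qed

text \<open>Encodes irreducibility of affine space: any two points lie on a curve along which every
  coordinate is a one-variable polynomial. For \<open>coords3\<close> and \<open>coords4\<close>
  this curve is the straight line.\<close>

definition line_connected :: "('a \<Rightarrow> complex) set \<Rightarrow> bool" where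
  "line_connected C \<longleftrightarrow>
     (\<forall>p q. \<exists>L. L 0 = p \<and> L 1 = q \<and> (\<forall>c\<in>C. \<exists>\<phi>. \<forall>t. c (L t) = poly \<phi> t))"

lemma affine_is_poly: "\<exists>\<phi>. \<forall>t. (a :: complex) + t * b = poly \<phi> t"
  by (intro exI[of _ "[:a, b:]"]) simp

lemma line_connected_coords3: "line_connected coords3"
  unfolding line_connected_def
proof (intro allI)
  fix p q :: cpx3
  obtain a b c a' b' c' where "p = (a, b, c)" "q = (a', b', c')" by (metis prod_cases3)
  then show "\<exists>L. L 0 = p \<and> L 1 = q \<and> (\<forall>c\<in>coords3. \<exists>\<phi>. \<forall>t. c (L t) = poly \<phi> t)"
    by (intro exI[of _ "\<lambda>t. (a + t * (a' - a), b + t * (b' - b), c + t * (c' - c))"])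
      (auto simp: coords3_iff affine_is_poly)
qed

lemma line_connected_coords4: "line_connected coords4"
  unfolding line_connected_def
proof (intro allI)
  fix p q :: cpx4
  obtain a b c d a' b' c' d' where "p = (a, b, c, d)" "q = (a', b', c', d')" by (metis prod_cases4)
  then show "\<exists>L. L 0 = p \<and> L 1 = q \<and> (\<forall>c\<in>coords4. \<exists>\<phi>. \<forall>t. c (L t) = poly \<phi> t)"
    by (intro exI[of _ "\<lambda>t. (a + t * (a' - a), b + t * (b' - b),
          c + t * (c' - c), d + t * (d' - d))"])
      (auto simp: coords4_iff affine_is_poly)
qed

text \<open>On a curve through \<open>p\<close> and \<open>q\<close> both functions become nonzero
  one-variable polynomials, whose product is nonzero and so has a non-root.\<close>

lemma poly_in_nonzero_mult:
  assumes "line_connected C" "poly_in C f" "poly_in C g" "f p \<noteq> 0" "g q \<noteq> 0"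
  obtains z where "f z \<noteq> 0" "g z \<noteq> 0"
proof -
  obtain L where L: "L 0 = p" "L 1 = q" "\<And>c. c \<in> C \<Longrightarrow> \<exists>\<phi>. \<forall>t. c (L t) = poly \<phi> t"
    using assms(1) unfolding line_connected_def by metis
  have restrict: "\<exists>\<phi>. \<forall>t. e (L t) = poly \<phi> t" if "poly_in C e" for e
    using that
  proof (induction rule: poly_in.induct)
    case (const a)
    show ?case by (intro exI[of _ "[:a:]"]) simp
  next
    case (add e e')
    then show ?case by (metis poly_add)
  next
    case (mult e e')
    then show ?case by (metis poly_mult)
  qed (rule L)
  obtain \<phi> \<theta> where "\<And>t. f (L t) = poly \<phi> t" "\<And>t. g (L t) = poly \<theta> t"
    using restrict assms(2,3) by metis
  moreover from this have "\<phi> * \<theta> \<noteq> 0"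
    using assms(4,5) L(1,2) by (metis mult_eq_0_iff poly_0)
  then obtain t where "poly (\<phi> * \<theta>) t \<noteq> 0"
    using poly_all_0_iff_0 by blast
  ultimately show ?thesis using that[of "L t"] by simp
qed

section \<open>Ideals generated by a monic quadratic\<close>

text \<open>Division by \<open>F\<close> leaves a remainder \<open>a u + b\<close> that is linear in \<open>u\<close>; vanishing at two distinct
  values of \<open>u\<close> over a generic point of the remaining coordinates kills it.\<close>

lemma monic_quadratic_generates:
  assumes C: "line_connected C" "C \<subseteq> insert u D" "D \<subseteq> C" "u \<in> C"
    and upd: "\<And>c q x. c \<in> D \<Longrightarrow> c (upd q x) = c q" "\<And>q x. u (upd q x) = x"
    and s: "poly_in D s" and r: "poly_in D r"
    and F: "\<And>q. F q = u q ^ 2 - s q * u q - r q"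
    and n: "poly_in D n" "n z \<noteq> 0"
    and roots: "\<And>q. n q \<noteq> 0 \<Longrightarrow> \<exists>x y. x \<noteq> y \<and> upd q x \<in> V \<and> upd q y \<in> V"
    and V: "\<And>q. q \<in> V \<Longrightarrow> F q = 0"
    and G: "poly_in C G" "\<And>q. q \<in> V \<Longrightarrow> G q = 0"
  shows "\<exists>H. poly_in C H \<and> (\<forall>q. G q = H q * F q)"
proof -
  have DC: "poly_in C f" if "poly_in D f" for f
    using poly_in_mono that C(3) by blast
  have u: "poly_in C u" using C(4) by (rule poly_in.coord)
  have FC: "poly_in C F"
  proof -
    have "F = (\<lambda>q. u q ^ 2 - s q * u q - r q)" using F by blast
    then show ?thesis by (simp only:) (intro poly_in_diff poly_in.mult poly_in_power u DC s r)
  qed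
  have "\<exists>H a b. poly_in C H \<and> poly_in D a \<and> poly_in D b \<and> (\<forall>q. G q = H q * F q + a q * u q + b q)"
    using G(1)
  proof (induction rule: poly_in.induct)
    case (coord c)
    show ?case
    proof (cases "c = u")
      case True
      then show ?thesis
        by (intro exI[of _ "\<lambda>_. 0"] exI[of _ "\<lambda>_. 1"]) (auto intro: poly_in.const)
    next
      case False
      then have "poly_in D c" using coord C(2) by (auto intro: poly_in.coord)
      then show ?thesis
        by (intro exI[of _ "\<lambda>_. 0"] exI[of _ c]) (auto intro: poly_in.const)
    qed
  next
    case (const a)
    show ?case
      by (intro exI[of _ "\<lambda>_. 0"] exI[of _ "\<lambda>_. a"]) (auto intro: poly_in.const)
  next
    case (add f g)
    then obtain H a b H' a' b' where
      *: "poly_in C H" "poly_in D a" "poly_in D b" "poly_in C H'" "poly_in D a'" "poly_in D b'"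
      "\<And>q. f q = H q * F q + a q * u q + b q" "\<And>q. g q = H' q * F q + a' q * u q + b' q"
      by metis
    show ?case
      by (intro exI[of _ "\<lambda>q. H q + H' q"] exI[of _ "\<lambda>q. a q + a' q"] exI[of _ "\<lambda>q. b q + b' q"]
          conjI poly_in.add * allI) (simp add: * algebra_simps)
  next
    case (mult f g)
    then obtain H a b H' a' b' where
      *: "poly_in C H" "poly_in D a" "poly_in D b" "poly_in C H'" "poly_in D a'" "poly_in D b'"
      "\<And>q. f q = H q * F q + a q * u q + b q" "\<And>q. g q = H' q * F q + a' q * u q + b' q"
      by metis
    show ?case
    proof (intro exI conjI allI)
      \<comment> \<open>The product of the linear remainders contains
        \<open>a q * a' q * u q ^ 2\<close>; replacing \<open>u q ^ 2\<close> by
        \<open>F q + s q * u q + r q\<close> yields all three witnesses.\<close>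
      show "poly_in C (\<lambda>q. H q * (H' q * F q + a' q * u q + b' q)
          + (a q * u q + b q) * H' q + a q * a' q)"
        by (intro poly_in.add poly_in.mult * FC u DC)
      show "poly_in D (\<lambda>q. a q * b' q + b q * a' q + a q * a' q * s q)"
        by (intro poly_in.add poly_in.mult * s)
      show "poly_in D (\<lambda>q. b q * b' q + a q * a' q * r q)"
        by (intro poly_in.add poly_in.mult * r)
      show "f q * g q = (H q * (H' q * F q + a' q * u q + b' q)
          + (a q * u q + b q) * H' q + a q * a' q) * F q
          + (a q * b' q + b q * a' q + a q * a' q * s q) * u q + (b q * b' q + a q * a' q * r q)" for q
        unfolding * F by algebra
    qed
  qed
  then obtain H a b where H: "poly_in C H" "poly_in D a" "poly_in D b"
    "\<And>q. G q = H q * F q + a q * u q + b q" by blast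
  have ab0: "a q = 0 \<and> b q = 0" if nq: "n q \<noteq> 0" for q
  proof -
    obtain x y where xy: "x \<noteq> y" "upd q x \<in> V" "upd q y \<in> V" using roots[OF nq] by blast
    \<comment> \<open>\<open>a\<close> and \<open>b\<close> do not involve \<open>u\<close>, so they
      agree at \<open>upd q z\<close> and \<open>q\<close>.\<close>
    have "a q * z + b q = 0" if "upd q z \<in> V" for z
      using G(2)[OF that] V[OF that] H(4)[of "upd q z"] upd(2)
        poly_in_cong_on[OF H(2), of "upd q z" q] poly_in_cong_on[OF H(3), of "upd q z" q] upd(1)
      by simp
    from this[OF xy(2)] this[OF xy(3)] have b: "a q * x + b q = 0" and "a q * y + b q = 0" .
    then have "a q * (x - y) = 0" by algebra
    with xy(1) b show ?thesis by simp
  qed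
  \<comment> \<open>\<open>n\<close> is not the zero polynomial, so vanishing wherever
    \<open>n\<close> is nonzero means vanishing identically.\<close>
  have "e q = 0" if "poly_in D e" "\<And>q. n q \<noteq> 0 \<Longrightarrow> e q = 0" for e q
    using poly_in_nonzero_mult[OF C(1) DC[OF that(1)] DC[OF n(1)] _ n(2)] that(2) by metis
  then have "a q = 0" "b q = 0" for q using ab0 H(2,3) by blast+
  then show ?thesis using H by auto
qed

section \<open>The glued threefold\<close>

lemma gpt_eq_bpt:
  "\<gamma> \<noteq> 0 \<Longrightarrow> gpt E (\<gamma>, w1, w2) = bpt E (1 / \<gamma>, w1 / \<gamma>, \<gamma> ^ 3 * w2 + deriv (E \<gamma>) w1)"
  unfolding gpt_def bpt_def
  by (auto intro!: equiv_class_eq[OF equiv_glue] simp: glue_def transition_def)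

lemma inj_bpt: "inj (bpt E)"
proof (rule injI)
  fix u v assume "bpt E u = bpt E v"
  then show "u = v"
    by (cases u, cases v)
      (auto simp: bpt_def glue_def transition_def dest!: eq_equiv_class[OF _ equiv_glue])
qed

lemma gpt_in_range_bpt_iff: "gpt E (\<gamma>, w1, w2) \<in> range (bpt E) \<longleftrightarrow> \<gamma> \<noteq> 0"
proof
  assume "gpt E (\<gamma>, w1, w2) \<in> range (bpt E)"
  then show "\<gamma> \<noteq> 0"
    by (auto simp: bpt_def gpt_def glue_def transition_def dest!: eq_equiv_class[OF _ equiv_glue])
qed (simp add: gpt_eq_bpt)

lemma threefold_eq: "threefold E = range (gpt E) \<union> range (bpt E)"
proof -
  have "x \<in> range (\<lambda>(a, b, c). GPatch a b c) \<union> range (\<lambda>(a, b, c). BPatch a b c)" for x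
    by (cases x) (auto simp: image_iff split_paired_Ex)
  then have "(UNIV :: patch_point set) =
      range (\<lambda>(a, b, c). GPatch a b c) \<union> range (\<lambda>(a, b, c). BPatch a b c)" by blast
  moreover have "threefold E = (\<lambda>x. glue E `` {x}) ` UNIV"
    by (auto simp: threefold_def quotient_def)
  ultimately have "threefold E = (\<lambda>x. glue E `` {x}) `
      (range (\<lambda>(a, b, c). GPatch a b c) \<union> range (\<lambda>(a, b, c). BPatch a b c))" by simp
  then show ?thesis
    by (simp add: gpt_def bpt_def image_Un image_image case_prod_unfold)
qed

text \<open>The overlap condition makes the case split \<open>R\<close> constant on each gluing
  class, so its image of the class is a singleton and \<open>the_elem\<close> returns the common
  value.\<close>

lemma glued_function:
  assumes "\<And>\<gamma> w1 w2. \<gamma> \<noteq> 0 \<Longrightarrow>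
    P' (\<gamma>, w1, w2) = P (1 / \<gamma>, w1 / \<gamma>, \<gamma> ^ 3 * w2 + deriv (E \<gamma>) w1)"
  obtains \<pi> where "\<And>g. \<pi> (gpt E g) = P' g" "\<And>v. \<pi> (bpt E v) = P v"
proof -
  define R where "R = case_patch_point (\<lambda>a b c. P' (a, b, c)) (\<lambda>a b c. P (a, b, c))"
  have "R ` (glue E `` {x}) = {R x}" for x
    using assms by (auto simp: R_def glue_def transition_def)
  then have "the_elem (R ` (glue E `` {x})) = R x" for x by simp
  then show ?thesis
    by (intro that[of "\<lambda>p. the_elem (R ` p)"]) (auto simp: gpt_def bpt_def R_def split: prod.splits)
qed

section \<open>Criterion for blowing down to a hypersurface\<close>

lemma zariski_open_nonzero: "poly_in C f \<Longrightarrow> zariski_open C {x. f x \<noteq> 0}"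
  unfolding zariski_open_def by (intro exI[of _ "{f}"]) auto

lemma zariski_openE:
  assumes "zariski_open C U" "x \<in> U"
  obtains f where "poly_in C f" "f x \<noteq> 0" "{y. f y \<noteq> 0} \<subseteq> U"
  using assms unfolding zariski_open_def by blast

text \<open>Reduces a blow-down to polynomial identities. \<open>P\<close> and \<open>P'\<close> are
  the blow-down map in the \<beta>- and \<gamma>-patches, and \<open>(a / h, b / h, c / h)\<close>
  is its inverse where \<open>h\<close> is nonzero. Hypothesis \<open>ideal\<close> concerns
  relations on the locus \<open>h q \<noteq> 0\<close> only, so it yields both the ideal of
  relations and the density of that locus.\<close>

lemma blows_down_toI:
  assumes F: "poly_in coords4 F"
    and P: "\<And>c. c \<in> coords4 \<Longrightarrow> poly_in coords3 (c \<circ> P)"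
    and P': "\<And>c. c \<in> coords4 \<Longrightarrow> poly_in coords3 (c \<circ> P')"
    and compat: "\<And>\<gamma> w1 w2. \<gamma> \<noteq> 0 \<Longrightarrow>
      P' (\<gamma>, w1, w2) = P (1 / \<gamma>, w1 / \<gamma>, \<gamma> ^ 3 * w2 + deriv (E \<gamma>) w1)"
    and P0: "\<And>\<beta>. P (\<beta>, 0, 0) = orig" and P'0: "\<And>\<gamma>. P' (\<gamma>, 0, 0) = orig"
    and fibre: "\<And>\<beta> v1 v2. P (\<beta>, v1, v2) = orig \<Longrightarrow> v1 = 0 \<and> v2 = 0"
    and fibre': "\<And>w1 w2. P' (0, w1, w2) = orig \<Longrightarrow> w1 = 0 \<and> w2 = 0"
    and sing: "singular_point F orig"
    and FP: "\<And>v. F (P v) = 0"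
    and abch: "poly_in coords4 a" "poly_in coords4 b" "poly_in coords4 c" "poly_in coords4 h"
    and h0: "h orig = 0" and hP: "h (P v) \<noteq> 0"
    and inv1: "\<And>\<beta> v1 v2. a (P (\<beta>, v1, v2)) = \<beta> * h (P (\<beta>, v1, v2)) \<and>
      b (P (\<beta>, v1, v2)) = v1 * h (P (\<beta>, v1, v2)) \<and> c (P (\<beta>, v1, v2)) = v2 * h (P (\<beta>, v1, v2))"
    and inv2: "\<And>q. F q = 0 \<Longrightarrow> h q \<noteq> 0 \<Longrightarrow> P (a q / h q, b q / h q, c q / h q) = q"
    and ideal: "\<And>G. poly_in coords4 G \<Longrightarrow> (\<And>q. F q = 0 \<Longrightarrow> h q \<noteq> 0 \<Longrightarrow> G q = 0) \<Longrightarrow>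
      \<exists>H. poly_in coords4 H \<and> (\<forall>q. G q = H q * F q)"
  shows "blows_down_to E F"
proof -
  obtain \<pi> where \<pi>: "\<And>g. \<pi> (gpt E g) = P' g" "\<And>v. \<pi> (bpt E v) = P v"
    using glued_function[of P' P E, OF compat] by metis
  have PP: "poly_in coords3 (\<lambda>v. f (P v))" "poly_in coords3 (\<lambda>v. f (P' v))"
    if "poly_in coords4 f" for f
    using poly_in_compose[OF that] P P' by blast+
  \<comment> \<open>Witnesses that the first coordinate, \<beta> or \<gamma>, is not the zero
    polynomial.\<close>
  define ones where "ones = (1 :: complex, 1 :: complex, 1 :: complex)"
  have dense3: "\<exists>z. f z \<noteq> 0 \<and> g z \<noteq> 0"
    if "poly_in coords3 f" "poly_in coords3 g" "f p \<noteq> 0" "g q \<noteq> 0" for f g p q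
    using poly_in_nonzero_mult[OF line_connected_coords3 that] by metis
  have hP': "\<exists>w. h (P' w) \<noteq> 0"
  proof -
    obtain z where z: "fst z \<noteq> 0" "h (P z) \<noteq> 0"
      using dense3[of fst "\<lambda>v. h (P v)" ones v] hP PP abch(4) poly_in_coords3 by (auto simp: ones_def)
    obtain \<beta> v1 v2 where zz: "z = (\<beta>, v1, v2)" by (metis prod_cases3)
    \<comment> \<open>The point of the \<gamma>-patch glued to \<open>z\<close>: the transition
      solved for \<open>w1\<close> and \<open>w2\<close>.\<close>
    let ?w = "(1 / \<beta>, v1 / \<beta>, \<beta> ^ 3 * (v2 - deriv (E (1 / \<beta>)) (v1 / \<beta>)))"
    have "P' ?w = P z"
      using z(1) by (subst compat) (auto simp: zz field_simps)
    then show ?thesis using z(2) by metis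
  qed
  \<comment> \<open>Compatibility gives vanishing on the overlap only; a nonzero polynomial would
    also be nonzero somewhere with \<open>\<gamma> \<noteq> 0\<close>.\<close>
  have FP': "F (P' w) = 0" for w
  proof (rule ccontr)
    assume "F (P' w) \<noteq> 0"
    then obtain z where "F (P' z) \<noteq> 0" "fst z \<noteq> 0"
      using dense3[of "\<lambda>v. F (P' v)" fst w ones] F PP poly_in_coords3 by (auto simp: ones_def)
    then show False using FP compat by (cases z) auto
  qed
  have F\<pi>: "F (\<pi> p) = 0" if "p \<in> threefold E" for p
    using that FP FP' \<pi> by (auto simp: threefold_eq)
  define U where "U = bpt E ` {v. h (P v) \<noteq> 0}"
  define V where "V = hypersurface F \<inter> {q. h q \<noteq> 0}"
  define \<psi> where "\<psi> q = bpt E (a q / h q, b q / h q, c q / h q)" for q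
  have \<pi>\<psi>: "\<psi> q \<in> U \<and> \<pi> (\<psi> q) = q" if "q \<in> V" for q
    using that inv2[of q] \<pi> by (auto simp: V_def hypersurface_def \<psi>_def U_def)
  have \<psi>\<pi>: "\<pi> p \<in> V \<and> \<psi> (\<pi> p) = p" if "p \<in> U" for p
    using that inv1 FP \<pi> by (auto simp: V_def hypersurface_def \<psi>_def U_def)
  have orig: "\<pi> p = orig" if "p \<in> exceptional_P1 E" for p
    using that \<pi> P0 P'0 by (auto simp: exceptional_P1_def)
  have fibre'': "w1 = 0 \<and> w2 = 0" if "P' (\<gamma>, w1, w2) = orig" for \<gamma> w1 w2
  proof (cases "\<gamma> = 0")
    case False
    \<comment> \<open>The point \<open>w1 = w2 = 0\<close> maps to \<open>orig\<close>, so
      \<open>fibre\<close> forces its coordinate \<open>v2\<close>, which is this derivative, to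
      vanish.\<close>
    have "deriv (E \<gamma>) 0 = 0" using fibre P'0[of \<gamma>] compat[OF False, of 0 0] by auto
    moreover have "w1 / \<gamma> = 0 \<and> \<gamma> ^ 3 * w2 + deriv (E \<gamma>) w1 = 0"
      using that compat[OF False, of w1 w2] by (intro fibre) simp
    ultimately show ?thesis using False by auto
  qed (use fibre' that in auto)
  have fibre_orig: "p \<in> exceptional_P1 E" if "p \<in> threefold E" "\<pi> p = orig" for p
    using that(1) unfolding threefold_eq
  proof (elim UnE rangeE)
    fix g assume "p = gpt E g"
    then show ?thesis using that(2) fibre'' by (cases g) (auto simp: \<pi> exceptional_P1_def)
  next
    fix v assume "p = bpt E v"
    moreover obtain \<beta> v1 v2 where "v = (\<beta>, v1, v2)" by (metis prod_cases3)
    ultimately show ?thesis using that(2) fibre[of \<beta> v1 v2] by (auto simp: \<pi> exceptional_P1_def)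
  qed
  have vU: "bpt E -` U = {v. h (P v) \<noteq> 0}"
    by (simp add: U_def inj_vimage_image_eq[OF inj_bpt])
  \<comment> \<open>\<open>U\<close> lies in the \<beta>-patch and so misses
    \<open>\<gamma> = 0\<close>; hence the factor \<open>fst w\<close>.\<close>
  have gU: "gpt E -` U = {w. fst w * h (P' w) \<noteq> 0}"
  proof (rule set_eqI)
    fix w :: cpx3
    obtain \<gamma> w1 w2 where w: "w = (\<gamma>, w1, w2)" by (metis prod_cases3)
    show "w \<in> gpt E -` U \<longleftrightarrow> w \<in> {w. fst w * h (P' w) \<noteq> 0}"
    proof (cases "\<gamma> = 0")
      case True
      then have "gpt E w \<notin> range (bpt E)" using gpt_in_range_bpt_iff w by blast
      then show ?thesis using True w by (auto simp: U_def)
    next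
      case False
      then show ?thesis
        using vU compat[OF False] by (auto simp: w gpt_eq_bpt set_eq_iff vimage_def)
    qed
  qed
  have Uo: "threefold_open E U"
    unfolding threefold_open_def vU gU
    by (intro conjI zariski_open_nonzero poly_in.mult poly_in_coords3 PP abch)
      (auto simp: U_def threefold_eq)
  \<comment> \<open>In one of the patches, the preimage of a nonempty open set contains the
    nonvanishing set of a nonzero \<open>f\<close>; this meets the nonvanishing set that describes
    \<open>U\<close> there.\<close>
  have Ud: "dense_wrt (threefold_open E) U"
    unfolding dense_wrt_def
  proof (intro allI impI; elim conjE)
    fix O' assume O': "threefold_open E O'" "O' \<noteq> {}"
    then have zo: "zariski_open coords3 (gpt E -` O')" "zariski_open coords3 (bpt E -` O')"
      by (simp_all add: threefold_open_def)
    obtain p where p: "p \<in> O'" using O'(2) by blast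
    then consider g where "p = gpt E g" | v where "p = bpt E v"
      using O'(1) by (auto simp: threefold_open_def threefold_eq)
    then show "O' \<inter> U \<noteq> {}"
    proof cases
      case 1
      then obtain f where f: "poly_in coords3 f" "f g \<noteq> 0" "{w. f w \<noteq> 0} \<subseteq> gpt E -` O'"
        using zariski_openE[OF zo(1)] p by (metis vimageI)
      obtain w where "h (P' w) \<noteq> 0" using hP' by blast
      then obtain z where "fst z \<noteq> 0" "h (P' z) \<noteq> 0"
        using dense3[of fst "\<lambda>v. h (P' v)" ones w] PP abch(4) poly_in_coords3 by (auto simp: ones_def)
      then obtain x where "f x \<noteq> 0" "fst x * h (P' x) \<noteq> 0"
        using dense3[OF f(1) poly_in.mult[OF poly_in_coords3(2) PP(2)[OF abch(4)]] f(2), of z]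
        by auto
      then have "x \<in> gpt E -` O'" "x \<in> gpt E -` U" using gU f(3) by auto
      then show ?thesis by auto
    next
      case 2
      then obtain f where f: "poly_in coords3 f" "f v \<noteq> 0" "{w. f w \<noteq> 0} \<subseteq> bpt E -` O'"
        using zariski_openE[OF zo(2)] p by (metis vimageI)
      then obtain x where "f x \<noteq> 0" "h (P x) \<noteq> 0"
        using dense3[OF f(1) PP(1)[OF abch(4)] f(2) hP] by blast
      then have "x \<in> bpt E -` O'" "x \<in> bpt E -` U" using vU f(3) by auto
      then show ?thesis by auto
    qed
  qed
  have Vo: "hypersurface_open F V"
    unfolding hypersurface_open_def V_def using zariski_open_nonzero[OF abch(4)] by blast
  have Vd: "dense_wrt (hypersurface_open F) V"
    unfolding dense_wrt_def
  proof (intro allI impI; elim conjE)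
    fix O' assume O': "hypersurface_open F O'" "O' \<noteq> {}"
    then obtain Q where Q: "zariski_open coords4 Q" "O' = hypersurface F \<inter> Q"
      unfolding hypersurface_open_def by blast
    then obtain q where q: "F q = 0" "q \<in> Q"
      using O'(2) unfolding hypersurface_def by blast
    obtain f where f: "poly_in coords4 f" "f q \<noteq> 0" "{x. f x \<noteq> 0} \<subseteq> Q"
      using zariski_openE[OF Q(1) q(2)] .
    show "O' \<inter> V \<noteq> {}"
    proof
      assume "O' \<inter> V = {}"
      \<comment> \<open>If the open set missed \<open>V\<close>, then \<open>f\<close> would vanish
        on the locus \<open>h q \<noteq> 0\<close> of the hypersurface, hence be a multiple of
        \<open>F\<close>, although it is nonzero at some zero of \<open>F\<close>.\<close>
      then have "f q = 0" if "F q = 0" "h q \<noteq> 0" for q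
        using that Q(2) f(3) by (auto simp: V_def hypersurface_def)
      then obtain H where "\<forall>q. f q = H q * F q" using ideal[OF f(1)] by blast
      with q f(2) show False by simp
    qed
  qed
  have reg: "regular_to_threefold E V \<psi>"
    unfolding regular_to_threefold_def
  proof
    fix q assume "q \<in> V"
    then show "\<exists>N a b c d. zariski_open coords4 N \<and> q \<in> N \<and>
        poly_in coords4 a \<and> poly_in coords4 b \<and> poly_in coords4 c \<and> poly_in coords4 d \<and>
        (\<forall>r\<in>V \<inter> N. d r \<noteq> 0) \<and>
        ((\<forall>r\<in>V \<inter> N. \<psi> r = gpt E (a r / d r, b r / d r, c r / d r)) \<or>
         (\<forall>r\<in>V \<inter> N. \<psi> r = bpt E (a r / d r, b r / d r, c r / d r)))"
      using zariski_open_nonzero[OF abch(4)] abch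
      by (intro exI[of _ "{q. h q \<noteq> 0}"] exI[of _ a] exI[of _ b] exI[of _ c] exI[of _ h])
        (auto simp: V_def \<psi>_def)
  qed
  have excl: "p \<notin> exceptional_P1 E" if "h (\<pi> p) \<noteq> 0" for p using that orig h0 by auto
  have bir: "birational_iso E F \<pi> (threefold E - exceptional_P1 E) (hypersurface F - {orig})"
    unfolding birational_iso_def
  proof (intro exI[of _ U] exI[of _ V] exI[of _ \<psi>] conjI)
    show "\<pi> ` (threefold E - exceptional_P1 E) \<subseteq> hypersurface F - {orig}"
    proof (intro image_subsetI)
      fix p assume p: "p \<in> threefold E - exceptional_P1 E"
      then have "\<pi> p \<noteq> orig" using fibre_orig by blast
      then show "\<pi> p \<in> hypersurface F - {orig}" using p F\<pi> by (simp add: hypersurface_def)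
    qed
    show "U \<subseteq> threefold E - exceptional_P1 E"
      using excl \<psi>\<pi> Uo by (auto simp: V_def threefold_open_def)
    show "V \<subseteq> hypersurface F - {orig}"
      using h0 by (auto simp: V_def)
  qed (use Uo Ud Vo Vd reg \<pi>\<psi> \<psi>\<pi> in auto)
  show ?thesis
    unfolding blows_down_to_def
  proof (intro exI[of _ \<pi>] exI[of _ orig] conjI ballI allI impI)
    show "global_fn E (c \<circ> \<pi>)" if "c \<in> coords4" for c
      using P[OF that] P'[OF that] by (simp add: global_fn_def o_def \<pi>)
    show "\<pi> ` exceptional_P1 E = {orig}"
      using orig by (auto simp: exceptional_P1_def image_iff)
    show "(\<forall>p\<in>threefold E. G (\<pi> p) = 0) \<longleftrightarrow> (\<exists>H. poly_in coords4 H \<and> (\<forall>q. G q = H q * F q))"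
      if G: "poly_in coords4 G" for G
    proof
      assume *: "\<forall>p\<in>threefold E. G (\<pi> p) = 0"
      have "G q = 0" if "F q = 0" "h q \<noteq> 0" for q
      proof -
        have "q \<in> V" using that by (simp add: V_def hypersurface_def)
        then show ?thesis using \<pi>\<psi>[of q] * Uo by (metis subsetD threefold_open_def)
      qed
      then show "\<exists>H. poly_in coords4 H \<and> (\<forall>q. G q = H q * F q)" by (rule ideal[OF G])
    next
      show "\<exists>H. poly_in coords4 H \<and> (\<forall>q. G q = H q * F q) \<Longrightarrow> \<forall>p\<in>threefold E. G (\<pi> p) = 0"
        using F\<pi> by (metis mult_zero_right)
    qed
  qed (fact sing bir)+
qed

section \<open>Potentials\<close>

lemma geometric_potential_deriv:
  "geometric_potential E dE \<Longrightarrow> \<gamma> \<noteq> 0 \<Longrightarrow> deriv (E \<gamma>) w = dE \<gamma> w"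
  unfolding geometric_potential_def by (blast intro: DERIV_imp_deriv)

lemma geometric_potential_unique:
  assumes "geometric_potential E dE" "geometric_potential E' dE" "\<gamma> \<noteq> 0"
  shows "E \<gamma> w = E' \<gamma> w"
proof -
  have "((\<lambda>w. E \<gamma> w - E' \<gamma> w) has_field_derivative 0) (at w)" for w
    using DERIV_diff[of "E \<gamma>" "dE \<gamma> w" w UNIV "E' \<gamma>" "dE \<gamma> w"] assms
    by (simp add: geometric_potential_def)
  then obtain c where "\<And>w. E \<gamma> w - E' \<gamma> w = c"
    using has_field_derivative_zero_constant[of UNIV "\<lambda>w. E \<gamma> w - E' \<gamma> w"] by auto
  then have "E \<gamma> w - E' \<gamma> w = E \<gamma> 0 - E' \<gamma> 0" by metis
  then show ?thesis using assms by (simp add: geometric_potential_def)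
qed

text \<open>Termwise integration normalised at \<open>w = 0\<close>, combined with uniqueness. All
  three perturbations have this two-term shape.\<close>

lemma geometric_potential_binomial:
  assumes "geometric_potential E (\<lambda>\<gamma> w. c \<gamma> * w^m + d \<gamma> * w^n)" "\<gamma> \<noteq> 0"
  shows "E \<gamma> w = c \<gamma> * (1 / of_nat (m + 1) * w^(m + 1)) + d \<gamma> * (1 / of_nat (n + 1) * w^(n + 1))"
proof (rule geometric_potential_unique[OF assms(1) _ assms(2)])
  have deriv: "((\<lambda>w. 1 / of_nat (k + 1) * w^(k + 1)) has_field_derivative (w :: complex)^k) (at w)" for k w
    by (rule derivative_eq_intros refl | simp del: of_nat_Suc)+
  show "geometric_potential (\<lambda>\<gamma> w. c \<gamma> * (1 / of_nat (m + 1) * w^(m + 1))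
      + d \<gamma> * (1 / of_nat (n + 1) * w^(n + 1))) (\<lambda>\<gamma> w. c \<gamma> * w^m + d \<gamma> * w^n)"
    unfolding geometric_potential_def
    by (intro allI impI conjI DERIV_add[OF DERIV_cmult[OF deriv] DERIV_cmult[OF deriv]]) simp
qed

text \<open>Clearing the pole of \<open>E\<close> by \<open>\<gamma> ^ j\<close> turns the integrand
  into \<open>f \<gamma> / \<gamma> ^ (j + 3)\<close>, whose residue is the coefficient of order
  \<open>j + 2\<close>. Types A and D take \<open>j = 0\<close>, type E7 takes
  \<open>j = 1\<close>.\<close>

lemma matrix_potential_eq_coeff:
  assumes "f has_fps_expansion \<Phi>"
    and "\<And>\<gamma>. \<gamma> \<noteq> 0 \<Longrightarrow> \<gamma> ^ j * E \<gamma> (x + \<gamma> * y) = f \<gamma>"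
  shows "matrix_potential E x y = fps_nth \<Phi> (j + 2)"
proof -
  have "\<gamma> powi (-3) * E \<gamma> (x + \<gamma> * y) = f \<gamma> / \<gamma> ^ Suc (j + 2)" if "\<gamma> \<noteq> 0" for \<gamma>
    using that assms(2)[OF that, symmetric]
    by (simp add: power_int_minus field_simps power_add eval_nat_numeral)
  then have "residue (\<lambda>\<gamma>. \<gamma> powi (-3) * E \<gamma> (x + \<gamma> * y)) 0 = residue (\<lambda>\<gamma>. f \<gamma> / \<gamma> ^ Suc (j + 2)) 0"
    by (intro residue_cong) (auto simp: eventually_at intro!: exI[of _ 1])
  then show ?thesis
    unfolding matrix_potential_def using residue_fps_expansion_over_power_at_0[OF assms(1)] by (rule trans)
qed

section \<open>Matrix model potentials of types A, D and E7\<close>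

lemma matrix_potential_A:
  assumes "geometric_potential E (\<lambda>\<gamma> w. \<gamma>^2 * w^k + w)"
  shows "matrix_potential E x y = 1 / of_nat (k + 1) * x^(k + 1) + 1 / 2 * y^2"
proof -
  have "geometric_potential E (\<lambda>\<gamma> w. \<gamma>^2 * w^k + 1 * w^1)" using assms by simp
  from geometric_potential_binomial[OF this]
  have E: "E \<gamma> w = \<gamma>^2 * (1 / of_nat (k + 1) * w^(k + 1)) + 1 / 2 * w^2" if "\<gamma> \<noteq> 0" for \<gamma> w
    using that by (simp only: one_add_one of_nat_numeral mult_1 simp_thms)
  \<comment> \<open>Only order 2 matters: behind the factor \<open>\<gamma>^2\<close> just the
    constant term \<open>x^(k + 1)\<close> of the power contributes, so it stays unexpanded.\<close>
  have fps: "(\<lambda>\<gamma>. \<gamma>^2 * (1 / of_nat (k + 1) * (x + \<gamma> * y)^(k + 1)) + (x^2 / 2 + \<gamma> * (x * y) + \<gamma>^2 * (y^2 / 2)))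
      has_fps_expansion fps_X^2 * (fps_const (1 / of_nat (k + 1)) *
        (fps_const x + fps_X * fps_const y)^(k + 1))
        + (fps_const (x^2 / 2) + fps_X * fps_const (x * y) + fps_X^2 * fps_const (y^2 / 2))"
    by (intro fps_expansion_intros)
  have w: "1 / 2 * (x + \<gamma> * y)^2 = x^2 / 2 + \<gamma> * (x * y) + \<gamma>^2 * (y^2 / 2)" for \<gamma>
    by (simp add: field_simps power2_eq_square)
  have "matrix_potential E x y = fps_nth (fps_X^2 * (fps_const (1 / of_nat (k + 1)) *
        (fps_const x + fps_X * fps_const y)^(k + 1))
        + (fps_const (x^2 / 2) + fps_X * fps_const (x * y) + fps_X^2 * fps_const (y^2 / 2))) (0 + 2)"
    by (rule matrix_potential_eq_coeff[OF fps]) (simp only: E w power_0 mult_1 simp_thms)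
  then show ?thesis
    by (simp add: fps_X_power_mult_nth fps_nth_power_0 del: of_nat_Suc power_Suc)
qed

lemma matrix_potential_D:
  assumes "geometric_potential E (\<lambda>\<gamma> w. \<gamma>^2 * w^k + w^2)"
  shows "matrix_potential E x y = 1 / of_nat (k + 1) * x^(k + 1) + x * y^2"
proof -
  have "geometric_potential E (\<lambda>\<gamma> w. \<gamma>^2 * w^k + 1 * w^2)" using assms by simp
  moreover have "2 + 1 = (3 :: nat)" by simp
  ultimately have E: "E \<gamma> w = \<gamma>^2 * (1 / of_nat (k + 1) * w^(k + 1)) + 1 / 3 * w^3" if "\<gamma> \<noteq> 0" for \<gamma> w
    using that geometric_potential_binomial[of E "\<lambda>\<gamma>. \<gamma>^2" k "\<lambda>_. 1" 2 \<gamma> w]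
    by (simp only: of_nat_numeral mult_1 simp_thms)
  have fps: "(\<lambda>\<gamma>. \<gamma>^2 * (1 / of_nat (k + 1) * (x + \<gamma> * y)^(k + 1))
        + (x^3 / 3 + \<gamma> * (x^2 * y) + \<gamma>^2 * (x * y^2) + \<gamma>^3 * (y^3 / 3)))
      has_fps_expansion fps_X^2 * (fps_const (1 / of_nat (k + 1)) *
        (fps_const x + fps_X * fps_const y)^(k + 1))
        + (fps_const (x^3 / 3) + fps_X * fps_const (x^2 * y) + fps_X^2 * fps_const (x * y^2)
          + fps_X^3 * fps_const (y^3 / 3))"
    by (intro fps_expansion_intros)
  have w: "1 / 3 * (x + \<gamma> * y)^3
      = x^3 / 3 + \<gamma> * (x^2 * y) + \<gamma>^2 * (x * y^2) + \<gamma>^3 * (y^3 / 3)" for \<gamma>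
    by (simp add: field_simps power2_eq_square power3_eq_cube)
  have "matrix_potential E x y = fps_nth (fps_X^2 * (fps_const (1 / of_nat (k + 1)) *
        (fps_const x + fps_X * fps_const y)^(k + 1))
        + (fps_const (x^3 / 3) + fps_X * fps_const (x^2 * y) + fps_X^2 * fps_const (x * y^2)
          + fps_X^3 * fps_const (y^3 / 3))) (0 + 2)"
    by (rule matrix_potential_eq_coeff[OF fps]) (simp only: E w power_0 mult_1 simp_thms)
  then show ?thesis
    by (simp add: fps_X_power_mult_nth fps_nth_power_0 del: of_nat_Suc power_Suc)
qed

lemma matrix_potential_E7:
  assumes "geometric_potential E (\<lambda>\<gamma> w. \<gamma> powi (-1) * w^2 + \<gamma> * w^3)"
  shows "matrix_potential E x y = 1 / 3 * y^3 + y * x^3"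
proof -
  note E = geometric_potential_binomial[of E "\<lambda>\<gamma>. \<gamma> powi (-1)" 2 "\<lambda>\<gamma>. \<gamma>" 3, OF assms]
  \<comment> \<open>This is \<open>\<gamma> * E \<gamma> (x + \<gamma> * y)\<close> sorted by powers
    of \<gamma>; its coefficient of order 3 is the potential.\<close>
  have "(\<lambda>\<gamma>. x^3 / 3 + \<gamma> * (x^2 * y) + \<gamma>^2 * (x * y^2 + x^4 / 4) + \<gamma>^3 * (y^3 / 3 + x^3 * y)
        + \<gamma>^4 * (3 / 2 * x^2 * y^2 + \<gamma> * (x * y^3) + \<gamma>^2 * (y^4 / 4)))
      has_fps_expansion fps_const (x^3 / 3) + fps_X * fps_const (x^2 * y)
        + fps_X^2 * fps_const (x * y^2 + x^4 / 4) + fps_X^3 * fps_const (y^3 / 3 + x^3 * y)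
        + fps_X^4 * (fps_const (3 / 2 * x^2 * y^2) + fps_X * fps_const (x * y^3)
          + fps_X^2 * fps_const (y^4 / 4))"
    by (intro fps_expansion_intros)
  then have "matrix_potential E x y = fps_nth (fps_const (x^3 / 3) + fps_X * fps_const (x^2 * y)
        + fps_X^2 * fps_const (x * y^2 + x^4 / 4) + fps_X^3 * fps_const (y^3 / 3 + x^3 * y)
        + fps_X^4 * (fps_const (3 / 2 * x^2 * y^2) + fps_X * fps_const (x * y^3)
          + fps_X^2 * fps_const (y^4 / 4))) (1 + 2)"
  proof (rule matrix_potential_eq_coeff)
    fix \<gamma> :: complex assume \<gamma>: "\<gamma> \<noteq> 0"
    have "\<gamma> ^ 1 * E \<gamma> w = 1 / 3 * w^3 + \<gamma>^2 * (1 / 4 * w^4)" for w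
      using \<gamma> E[OF \<gamma>, of w]
      by (simp add: power_int_minus field_simps power2_eq_square power3_eq_cube)
    also have "1 / 3 * (x + \<gamma> * y)^3 + \<gamma>^2 * (1 / 4 * (x + \<gamma> * y)^4) = x^3 / 3 + \<gamma> * (x^2 * y) + \<gamma>^2 * (x * y^2 + x^4 / 4) + \<gamma>^3 * (y^3 / 3 + x^3 * y)
        + \<gamma>^4 * (3 / 2 * x^2 * y^2 + \<gamma> * (x * y^3) + \<gamma>^2 * (y^4 / 4))"
      by (simp add: field_simps power2_eq_square power3_eq_cube power4_eq_xxxx)
    finally show "\<gamma> ^ 1 * E \<gamma> (x + \<gamma> * y) = \<dots>" .
  qed
  then show ?thesis
    by (simp add: fps_X_power_mult_nth)
qed

section \<open>The singular geometries\<close>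

abbreviation "coords_YZT \<equiv>
  {\<lambda>q :: cpx4. fst (snd q), \<lambda>q. fst (snd (snd q)), \<lambda>q. snd (snd (snd q))}"

text \<open>The roots are the two square roots of \<open>r q\<close>, distinct once
  \<open>r q\<close> is nonzero. They are then nonzero themselves, so \<open>nh\<close> asks for a
  nonzero denominator only at \<open>x \<noteq> 0\<close>, which admits
  \<open>h = fst\<close>.\<close>

lemma square_generates:
  assumes r: "poly_in coords_YZT r"
    and n: "poly_in coords_YZT n" "n z \<noteq> 0"
    and nr: "\<And>q. n q \<noteq> 0 \<Longrightarrow> r q \<noteq> 0"
    and nh: "\<And>q x. n q \<noteq> 0 \<Longrightarrow> x \<noteq> 0 \<Longrightarrow> h (x, snd q) \<noteq> 0"
    and F: "\<And>q. F q = fst q ^ 2 - r q"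
    and G: "poly_in coords4 G" "\<And>q. F q = 0 \<Longrightarrow> h q \<noteq> 0 \<Longrightarrow> G q = 0"
  shows "\<exists>H. poly_in coords4 H \<and> (\<forall>q. G q = H q * F q)"
proof (rule monic_quadratic_generates[where u = fst and upd = "\<lambda>q x. (x, snd q)"
      and V = "{q. F q = 0 \<and> h q \<noteq> 0}" and s = "\<lambda>_. 0" and D = coords_YZT and z = z])
  fix q assume nq: "n q \<noteq> 0"
  have rr: "r (x, snd q) = r q" for x
    by (rule poly_in_cong_on[OF r]) auto
  have "F (x, snd q) = 0" if "x ^ 2 = r q" for x
    using that by (simp only: F rr fst_conv right_minus_eq)
  then show "\<exists>x y. x \<noteq> y \<and> (x, snd q) \<in> {q. F q = 0 \<and> h q \<noteq> 0} \<and> (y, snd q) \<in> {q. F q = 0 \<and> h q \<noteq> 0}"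
    using nr[OF nq] nh[OF nq]
    by (intro exI[of _ "csqrt (r q)"] exI[of _ "- csqrt (r q)"]) simp
next
  show "G q = 0" if "q \<in> {q. F q = 0 \<and> h q \<noteq> 0}" for q
    using G(2) that by blast
  show "F q = fst q ^ 2 - 0 * fst q - r q" for q
    unfolding F by simp
qed (fact line_connected_coords4 r n G(1) | force simp: coords4_iff intro: poly_in.const)+

text \<open>With \<open>T = \<gamma> * w2 + w1^k\<close> the transition reads
  \<open>v2 = w1 + \<gamma>^2 * T\<close>, so \<open>X = \<beta> * v2 - v1\<close> becomes
  \<open>\<gamma> * T\<close>, and \<open>T = \<beta> * X\<close> is global. With
  \<open>Z = v2\<close>, the difference \<open>Z^k - T\<close> is divisible by \<gamma>, so
  \<open>Y = \<beta> * (Z^k - T)\<close> is global too. Multiplying by \<open>X\<close> gives the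
  equation.\<close>

lemma blows_down_to_A:
  fixes k :: nat
  assumes k: "k \<ge> 1" and E: "geometric_potential E (\<lambda>\<gamma> w. \<gamma>^2 * w^k + w)"
  shows "blows_down_to E (\<lambda>(X, Y, Z, T). X * Y - T * (Z^k - T))"
proof -
  define T' :: "cpx3 \<Rightarrow> complex" where "T' = (\<lambda>q. fst q * snd (snd q) + fst (snd q) ^ k)"
  have T': "poly_in coords3 T'" unfolding T'_def by (intro poly_in_rules)
  have d: "poly_in coords3 (\<lambda>q. fst q ^ 2 * T' q)" by (intro poly_in_rules T')
  obtain p where p: "poly_in coords3 p"
    "\<And>q. (fst (snd q) + fst q ^ 2 * T' q) ^ k = fst (snd q) ^ k + (fst q ^ 2 * T' q) * p q"
    by (rule poly_in_power_expand[OF poly_in_coords3(3) d, of k]) (rule that)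
  define P :: "cpx3 \<Rightarrow> cpx4" where
    "P = (\<lambda>q. let \<beta> = fst q; v1 = fst (snd q); v2 = snd (snd q); X = \<beta> * v2 - v1; T = \<beta> * X
       in (X, \<beta> * (v2 ^ k - T), v2, T))"
  define P' :: "cpx3 \<Rightarrow> cpx4" where
    "P' = (\<lambda>q. (fst q * T' q, fst q * T' q * p q - snd (snd q), fst (snd q) + fst q ^ 2 * T' q, T' q))"
  show ?thesis
  \<comment> \<open>The inverse is \<open>\<beta> = T / X\<close>, \<open>v2 = Z\<close>,
    \<open>v1 = \<beta> * Z - X\<close>. At \<open>v\<close> the denominator \<open>X\<close> is
    -1.\<close>
  proof (rule blows_down_toI[where P = P and P' = P' and orig = "(0, 0, 0, 0)" and v = "(0, 1, 0)"
        and a = "\<lambda>q. snd (snd (snd q))" and h = fst and c = "\<lambda>q. fst (snd (snd q)) * fst q"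
        and b = "\<lambda>q. snd (snd (snd q)) * fst (snd (snd q)) - fst q ^ 2"])
    show "poly_in coords4 (\<lambda>(X, Y, Z, T). X * Y - T * (Z^k - T))"
      unfolding case_prod_unfold by (intro poly_in_rules)
    show "poly_in coords3 (c \<circ> P)" if "c \<in> coords4" for c
      using that by (auto simp: coords4_iff P_def Let_def o_def intro!: poly_in_rules)
    show "poly_in coords3 (c \<circ> P')" if "c \<in> coords4" for c
      using that by (auto simp: coords4_iff P'_def o_def intro!: poly_in_rules T' p)
    show "P' (\<gamma>, w1, w2) = P (1 / \<gamma>, w1 / \<gamma>, \<gamma> ^ 3 * w2 + deriv (E \<gamma>) w1)" if "\<gamma> \<noteq> 0" for \<gamma> w1 w2
    proof -
      define T where "T = \<gamma> * w2 + w1 ^ k"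
      have T: "T' (\<gamma>, w1, w2) = T" by (simp add: T'_def T_def)
      have v2: "\<gamma> ^ 3 * w2 + deriv (E \<gamma>) w1 = w1 + \<gamma>^2 * T"
        unfolding geometric_potential_deriv[OF E that] T_def by algebra
      have pw: "(w1 + \<gamma>^2 * T) ^ k = w1 ^ k + \<gamma>^2 * T * p (\<gamma>, w1, w2)"
        using p(2)[of "(\<gamma>, w1, w2)"] T by simp
      have "1 / \<gamma> * (w1 + \<gamma>^2 * T) - w1 / \<gamma> = \<gamma> * T"
        using that by (simp add: field_simps power2_eq_square)
      moreover have "1 / \<gamma> * (\<gamma> * T) = T" using that by simp
      moreover have "1 / \<gamma> * (w1 ^ k + \<gamma>^2 * T * p (\<gamma>, w1, w2) - T) = \<gamma> * T * p (\<gamma>, w1, w2) - w2"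
        using that by (simp add: T_def field_simps power2_eq_square)
      ultimately show ?thesis
        unfolding P_def P'_def v2 Let_def fst_conv snd_conv T by (simp only: pw)
    qed
    \<comment> \<open>The \<open>T\<close>-derivative at the origin is \<open>- (0^k)\<close>, which
      vanishes as \<open>k \<ge> 1\<close>.\<close>
    show "singular_point (\<lambda>(X, Y, Z, T). X * Y - T * (Z^k - T)) (0, 0, 0, 0)"
      using k by (auto simp: singular_point_def intro!: DERIV_imp_deriv derivative_eq_intros)
    show "P (\<beta>, v1, v2) = (0, 0, 0, 0) \<Longrightarrow> v1 = 0 \<and> v2 = 0" for \<beta> v1 v2
      by (auto simp: P_def Let_def)
    show "P' (0, w1, w2) = (0, 0, 0, 0) \<Longrightarrow> w1 = 0 \<and> w2 = 0" for w1 w2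
      by (simp add: P'_def)
    show "P (snd (snd (snd q)) / fst q, (snd (snd (snd q)) * fst (snd (snd q)) - fst q ^ 2) / fst q,
        fst (snd (snd q)) * fst q / fst q) = q"
      if "(\<lambda>(X, Y, Z, T). X * Y - T * (Z^k - T)) q = 0" "fst q \<noteq> 0" for q
    proof -
      obtain X Y Z T where q: "q = (X, Y, Z, T)" by (metis prod_cases4)
      have X: "X \<noteq> 0" "X * Y = T * (Z ^ k - T)" using that by (auto simp: q)
      have "T / X * Z - (T * Z - X^2) / X = X" "T / X * X = T"
        using X(1) by (simp_all add: diff_divide_distrib power2_eq_square)
      moreover have "T / X * (Z ^ k - T) = Y"
        using X(1) by (simp only: times_divide_eq_left X(2)[symmetric] nonzero_mult_div_cancel_left simp_thms)
      ultimately show ?thesis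
        using X(1) by (simp only: q P_def Let_def fst_conv snd_conv nonzero_mult_div_cancel_right simp_thms)
    qed
    show "\<exists>H. poly_in coords4 H \<and> (\<forall>q. G q = H q * (\<lambda>(X, Y, Z, T). X * Y - T * (Z^k - T)) q)"
      if G: "poly_in coords4 G"
        "\<And>q. (\<lambda>(X, Y, Z, T). X * Y - T * (Z^k - T)) q = 0 \<Longrightarrow> fst q \<noteq> 0 \<Longrightarrow> G q = 0" for G
    \<comment> \<open>The equation is linear in \<open>X\<close> and in \<open>Y\<close>, so
      \<open>T\<close> is the quadratic variable: \<open>T^2 - Z^k * T + X * Y = 0\<close>. In
      \<open>n\<close> the discriminant separates the roots and the factor \<open>X\<close> keeps
      the denominator nonzero.\<close>
    proof (rule monic_quadratic_generates[where u = "\<lambda>q. snd (snd (snd q))"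
          and D = "{\<lambda>q. fst q, \<lambda>q. fst (snd q), \<lambda>q. fst (snd (snd q))}"
          and upd = "\<lambda>(X, Y, Z, T) x. (X, Y, Z, x)"
          and V = "{q. (\<lambda>(X, Y, Z, T). X * Y - T * (Z^k - T)) q = 0 \<and> fst q \<noteq> 0}"
          and s = "\<lambda>q. fst (snd (snd q)) ^ k" and r = "\<lambda>q. - (fst q * fst (snd q))"
          and n = "\<lambda>q. fst q * ((fst (snd (snd q)) ^ k) ^ 2 - 4 * (fst q * fst (snd q)))"
          and z = "(1, 1, 0, 0)"])
      fix q :: cpx4
      assume nq: "fst q * ((fst (snd (snd q)) ^ k) ^ 2 - 4 * (fst q * fst (snd q))) \<noteq> 0"
      obtain X Y Z T where q: "q = (X, Y, Z, T)" by (metis prod_cases4)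
      define d where "d = csqrt ((Z ^ k) ^ 2 - 4 * (X * Y))"
      have d: "d \<noteq> 0" "d ^ 2 = (Z ^ k) ^ 2 - 4 * (X * Y)" "X \<noteq> 0" using nq by (auto simp: q d_def)
      have "X * Y - (Z ^ k + e) / 2 * (Z ^ k - (Z ^ k + e) / 2) = 0"
        if "e ^ 2 = (Z ^ k) ^ 2 - 4 * (X * Y)" for e
        using that by (simp add: field_simps power2_eq_square)
      from this[of d] this[of "- d"] d show "\<exists>x y. x \<noteq> y \<and>
          (case q of (X, Y, Z, T) \<Rightarrow> \<lambda>x. (X, Y, Z, x)) x
            \<in> {q. (\<lambda>(X, Y, Z, T). X * Y - T * (Z^k - T)) q = 0 \<and> fst q \<noteq> 0} \<and>
          (case q of (X, Y, Z, T) \<Rightarrow> \<lambda>x. (X, Y, Z, x)) y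
            \<in> {q. (\<lambda>(X, Y, Z, T). X * Y - T * (Z^k - T)) q = 0 \<and> fst q \<noteq> 0}"
        by (intro exI[of _ "(Z ^ k + d) / 2"] exI[of _ "(Z ^ k + (- d)) / 2"]) (simp add: q)
    next
      show "poly_in {\<lambda>q. fst q, \<lambda>q. fst (snd q), \<lambda>q. fst (snd (snd q))}
          (\<lambda>q. fst q * ((fst (snd (snd q)) ^ k) ^ 2 - 4 * (fst q * fst (snd q))))"
        by (intro poly_in_intros poly_in_diff poly_in_power poly_in.coord) auto
      show "poly_in {\<lambda>q. fst q, \<lambda>q. fst (snd q), \<lambda>q. fst (snd (snd q))}
          (\<lambda>q. fst (snd (snd q)) ^ k)"
        by (intro poly_in_power poly_in.coord) auto
      show "poly_in {\<lambda>q. fst q, \<lambda>q. fst (snd q), \<lambda>q. fst (snd (snd q))}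
          (\<lambda>q. - (fst q * fst (snd q)))"
        by (intro poly_in_uminus poly_in.mult poly_in.coord) auto
    qed (use k G in \<open>auto simp: coords4_iff line_connected_coords4 algebra_simps power2_eq_square power_0_left
        split: prod.splits\<close>)
  qed (use k in \<open>auto simp: P_def P'_def T'_def Let_def algebra_simps power2_eq_square
        intro!: poly_in_rules\<close>)
qed

text \<open>Since \<open>v2 = w1^2 + \<gamma>^2 * T\<close> with
  \<open>T = \<gamma> * w2 + w1^(2 * m)\<close>, the function
  \<open>T = \<beta>^2 * v2 - v1^2\<close> is global. With \<open>Z = v2\<close>, the difference
  \<open>Q = Z^m - T\<close> is divisible by \<gamma>, so \<open>X = v1 * Q\<close> and
  \<open>Y = \<beta> * Q\<close> are global; eliminating \<open>v1\<close> and \<beta> from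
  \<open>T\<close> gives the equation.\<close>

lemma blows_down_to_D_even:
  fixes m :: nat
  assumes m: "m \<ge> 1" and E: "geometric_potential E (\<lambda>\<gamma> w. \<gamma>^2 * w^(2 * m) + w^2)"
  shows "blows_down_to E (\<lambda>(X, Y, Z, T). X^2 - Y^2 * Z + T * (Z^m - T)^2)"
proof -
  define T' :: "cpx3 \<Rightarrow> complex" where "T' = (\<lambda>q. fst q * snd (snd q) + fst (snd q) ^ (2 * m))"
  have T': "poly_in coords3 T'" unfolding T'_def by (intro poly_in_rules)
  have w: "poly_in coords3 (\<lambda>q. fst (snd q) ^ 2)" by (intro poly_in_rules)
  have d: "poly_in coords3 (\<lambda>q. fst q ^ 2 * T' q)" by (intro poly_in_rules T')
  obtain p where p: "poly_in coords3 p"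
    "\<And>q. (fst (snd q) ^ 2 + fst q ^ 2 * T' q) ^ m = (fst (snd q) ^ 2) ^ m + (fst q ^ 2 * T' q) * p q"
    by (rule poly_in_power_expand[OF w d, of m]) (rule that)
  define P :: "cpx3 \<Rightarrow> cpx4" where
    "P = (\<lambda>q. let \<beta> = fst q; v1 = fst (snd q); v2 = snd (snd q); T = \<beta>^2 * v2 - v1^2
       in (v1 * (v2 ^ m - T), \<beta> * (v2 ^ m - T), v2, T))"
  define Y' :: "cpx3 \<Rightarrow> complex" where "Y' = (\<lambda>q. fst q * T' q * p q - snd (snd q))"
  have Y': "poly_in coords3 Y'" unfolding Y'_def by (intro poly_in_rules T' p)
  define P' :: "cpx3 \<Rightarrow> cpx4" where
    "P' = (\<lambda>q. (fst (snd q) * Y' q, Y' q, fst (snd q) ^ 2 + fst q ^ 2 * T' q, T' q))"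
  show ?thesis
  proof (rule blows_down_toI[where P = P and P' = P' and orig = "(0, 0, 0, 0)" and v = "(0, 1, 0)"
        and a = "\<lambda>q. fst (snd q)" and h = "\<lambda>q. fst (snd (snd q)) ^ m - snd (snd (snd q))" and b = fst
        and c = "\<lambda>q. fst (snd (snd q)) * (fst (snd (snd q)) ^ m - snd (snd (snd q)))"])
    show "poly_in coords4 (\<lambda>(X, Y, Z, T). X^2 - Y^2 * Z + T * (Z^m - T)^2)"
      unfolding case_prod_unfold by (intro poly_in_rules)
    show "poly_in coords3 (c \<circ> P)" if "c \<in> coords4" for c
      using that by (auto simp: coords4_iff P_def Let_def o_def intro!: poly_in_rules)
    show "poly_in coords3 (c \<circ> P')" if "c \<in> coords4" for c
      using that by (auto simp: coords4_iff P'_def o_def intro!: poly_in_rules T' Y')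
    show "P' (\<gamma>, w1, w2) = P (1 / \<gamma>, w1 / \<gamma>, \<gamma> ^ 3 * w2 + deriv (E \<gamma>) w1)" if "\<gamma> \<noteq> 0" for \<gamma> w1 w2
    proof -
      define T where "T = \<gamma> * w2 + w1 ^ (2 * m)"
      define y where "y = Y' (\<gamma>, w1, w2)"
      have T: "T' (\<gamma>, w1, w2) = T" by (simp add: T'_def T_def)
      have v2: "\<gamma> ^ 3 * w2 + deriv (E \<gamma>) w1 = w1^2 + \<gamma>^2 * T"
        unfolding geometric_potential_deriv[OF E that] T_def by algebra
      have "(w1^2 + \<gamma>^2 * T) ^ m = w1 ^ (2 * m) + \<gamma>^2 * T * p (\<gamma>, w1, w2)"
        using p(2)[of "(\<gamma>, w1, w2)"] T by (simp add: power_mult)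
      \<comment> \<open>The terms \<open>w1 ^ (2 * m)\<close> cancel; what remains has the factor
        \<gamma>.\<close>
      then have Q: "(w1^2 + \<gamma>^2 * T) ^ m - T = \<gamma> * y"
        by (simp add: y_def Y'_def T) (simp add: T_def algebra_simps power2_eq_square)
      have "(1 / \<gamma>)^2 * (w1^2 + \<gamma>^2 * T) - (w1 / \<gamma>)^2 = T"
        using that by (simp add: field_simps)
      moreover have "1 / \<gamma> * (\<gamma> * y) = y" "w1 / \<gamma> * (\<gamma> * y) = w1 * y" using that by simp_all
      ultimately show ?thesis
        unfolding P_def P'_def v2 Let_def fst_conv snd_conv T by (simp only: Q y_def)
    qed
    show "singular_point (\<lambda>(X, Y, Z, T). X^2 - Y^2 * Z + T * (Z^m - T)^2) (0, 0, 0, 0)"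
      using m by (auto simp: singular_point_def intro!: DERIV_imp_deriv derivative_eq_intros)
    show "P (\<beta>, v1, v2) = (0, 0, 0, 0) \<Longrightarrow> v1 = 0 \<and> v2 = 0" for \<beta> v1 v2
      by (auto simp: P_def Let_def)
    show "P' (0, w1, w2) = (0, 0, 0, 0) \<Longrightarrow> w1 = 0 \<and> w2 = 0" for w1 w2
      by (simp add: P'_def Y'_def)
    show "P (fst (snd q) / (fst (snd (snd q)) ^ m - snd (snd (snd q))),
        fst q / (fst (snd (snd q)) ^ m - snd (snd (snd q))),
        fst (snd (snd q)) * (fst (snd (snd q)) ^ m - snd (snd (snd q)))
          / (fst (snd (snd q)) ^ m - snd (snd (snd q)))) = q"
      if "(\<lambda>(X, Y, Z, T). X^2 - Y^2 * Z + T * (Z^m - T)^2) q = 0"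
        "fst (snd (snd q)) ^ m - snd (snd (snd q)) \<noteq> 0" for q
    proof -
      obtain X Y Z T where q: "q = (X, Y, Z, T)" by (metis prod_cases4)
      define Q where "Q = Z ^ m - T"
      have Q: "Q \<noteq> 0" "X^2 - Y^2 * Z + T * Q^2 = 0" using that by (auto simp: q Q_def)
      have "(Y / Q)^2 * Z - (X / Q)^2 = (Y^2 * Z - X^2) / Q^2" by (simp add: power_divide diff_divide_distrib)
      also have "Y^2 * Z - X^2 = T * Q^2" using Q(2) by algebra
      finally have "(Y / Q)^2 * Z - (X / Q)^2 = T" using Q(1) by simp
      then show ?thesis using Q(1) by (simp add: q P_def Let_def Q_def[symmetric])
    qed
    show "\<exists>H. poly_in coords4 H \<and> (\<forall>q. G q = H q * (\<lambda>(X, Y, Z, T). X^2 - Y^2 * Z + T * (Z^m - T)^2) q)"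
      if G: "poly_in coords4 G"
        "\<And>q. (\<lambda>(X, Y, Z, T). X^2 - Y^2 * Z + T * (Z^m - T)^2) q = 0 \<Longrightarrow>
          fst (snd (snd q)) ^ m - snd (snd (snd q)) \<noteq> 0 \<Longrightarrow> G q = 0" for G
    proof (rule square_generates[where h = "\<lambda>q. fst (snd (snd q)) ^ m - snd (snd (snd q))",
          OF _ _ _ _ _ _ G])
      let ?r = "\<lambda>q :: cpx4. fst (snd q) ^ 2 * fst (snd (snd q))
        - snd (snd (snd q)) * (fst (snd (snd q)) ^ m - snd (snd (snd q))) ^ 2"
      let ?n = "\<lambda>q :: cpx4. ?r q * (fst (snd (snd q)) ^ m - snd (snd (snd q)))"
      show "poly_in coords_YZT ?r" "poly_in coords_YZT ?n"
        by (intro poly_in_intros poly_in_diff poly_in_power poly_in.coord; simp)+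
      show "?n (0, 1, 1, 0) \<noteq> 0" by simp
    qed (simp_all split: prod.splits)
  qed (use m in \<open>auto simp: P_def P'_def T'_def Y'_def Let_def algebra_simps power2_eq_square power_0_left
        intro!: poly_in_rules\<close>)
qed

text \<open>Put \<open>s^2 = Z = v2\<close> and \<open>k = 2 * m + 1\<close>. The functions satisfy
  \<open>X + s * Y = (v1 + s * \<beta>) * (s^k - T)\<close> and
  \<open>T = \<beta>^2 * Z - v1^2\<close>; multiplying the first by its conjugate under the sign
  change of \<open>s\<close> gives the equation.\<close>

lemma blows_down_to_D_odd:
  fixes m :: nat
  assumes E: "geometric_potential E (\<lambda>\<gamma> w. \<gamma>^2 * w^(2 * m + 1) + w^2)"
  shows "blows_down_to E (\<lambda>(X, Y, Z, T). X^2 - Y^2 * Z - T * (Z^(2 * m + 1) - T^2))"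
proof -
  have pow: "Z ^ (2 * m + 1) = Z * (Z ^ m)^2" for Z :: complex
    by (simp add: power_mult power_mult_distrib mult.commute[of 2])
  define T' :: "cpx3 \<Rightarrow> complex" where "T' = (\<lambda>q. fst q * snd (snd q) + fst (snd q) * (fst (snd q) ^ 2) ^ m)"
  have T': "poly_in coords3 T'" unfolding T'_def by (intro poly_in_rules)
  have w: "poly_in coords3 (\<lambda>q. fst (snd q) ^ 2)" by (intro poly_in_rules)
  have d: "poly_in coords3 (\<lambda>q. fst q ^ 2 * T' q)" by (intro poly_in_rules T')
  obtain p where p: "poly_in coords3 p"
    "\<And>q. (fst (snd q) ^ 2 + fst q ^ 2 * T' q) ^ m = (fst (snd q) ^ 2) ^ m + (fst q ^ 2 * T' q) * p q"
    by (rule poly_in_power_expand[OF w d, of m]) (rule that)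
  define P :: "cpx3 \<Rightarrow> cpx4" where
    "P = (\<lambda>q. let \<beta> = fst q; v1 = fst (snd q); v2 = snd (snd q); T = \<beta>^2 * v2 - v1^2
       in (\<beta> * (v2 * v2 ^ m) - v1 * T, v1 * v2 ^ m - \<beta> * T, v2, T))"
  define Z' :: "cpx3 \<Rightarrow> complex" where "Z' = (\<lambda>q. fst (snd q) ^ 2 + fst q ^ 2 * T' q)"
  have Z': "poly_in coords3 Z'" unfolding Z'_def by (intro poly_in_rules T')
  define Y' :: "cpx3 \<Rightarrow> complex" where
    "Y' = (\<lambda>q. fst q * fst (snd q) * T' q * p q - snd (snd q))"
  have Y': "poly_in coords3 Y'" unfolding Y'_def by (intro poly_in_rules T' p)
  define P' :: "cpx3 \<Rightarrow> cpx4" where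
    "P' = (\<lambda>q. (fst (snd q) * Y' q + fst q * T' q * Z' q ^ m, Y' q, Z' q, T' q))"
  define h :: "cpx4 \<Rightarrow> complex" where
    "h = (\<lambda>q. snd (snd (snd q)) ^ 2 - fst (snd (snd q)) * (fst (snd (snd q)) ^ m) ^ 2)"
  have h: "poly_in coords4 h" unfolding h_def by (intro poly_in_rules)
  let ?F = "\<lambda>(X, Y, Z, T). X^2 - Y^2 * Z - T * (Z^(2 * m + 1) - T^2)"
  show ?thesis
  \<comment> \<open>To invert, multiply \<open>X + s * Y\<close> by the conjugate factor
    \<open>- (s^k) - T\<close> and divide by the norm \<open>h = T^2 - Z^k\<close>; the parts free
    of \<open>s\<close> and linear in \<open>s\<close> are \<open>v1\<close> and \<beta>.\<close>
  proof (rule blows_down_toI[where P = P and P' = P' and orig = "(0, 0, 0, 0)" and v = "(0, 1, 0)"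
        and h = h and c = "\<lambda>q. fst (snd (snd q)) * h q"
        and a = "\<lambda>q. - (snd (snd (snd q)) * fst (snd q) + fst (snd (snd q)) ^ m * fst q)"
        and b = "\<lambda>q. - (snd (snd (snd q)) * fst q
          + fst (snd (snd q)) * fst (snd (snd q)) ^ m * fst (snd q))"])
    show "poly_in coords4 ?F"
      unfolding case_prod_unfold by (intro poly_in_rules)
    show "poly_in coords3 (c \<circ> P)" if "c \<in> coords4" for c
      using that by (auto simp: coords4_iff P_def Let_def o_def intro!: poly_in_rules)
    show "poly_in coords3 (c \<circ> P')" if "c \<in> coords4" for c
      using that by (auto simp: coords4_iff P'_def o_def intro!: poly_in_rules T' Y' Z')
    show "P' (\<gamma>, w1, w2) = P (1 / \<gamma>, w1 / \<gamma>, \<gamma> ^ 3 * w2 + deriv (E \<gamma>) w1)" if "\<gamma> \<noteq> 0" for \<gamma> w1 w2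
    proof -
      define T where "T = \<gamma> * w2 + w1 * (w1^2) ^ m"
      define y where "y = Y' (\<gamma>, w1, w2)"
      define z where "z = w1^2 + \<gamma>^2 * T"
      have T: "T' (\<gamma>, w1, w2) = T" by (simp add: T'_def T_def)
      have Z: "Z' (\<gamma>, w1, w2) = z" by (simp add: Z'_def z_def T)
      have "w1 ^ (2 * m + 1) = w1 * (w1^2) ^ m" by (simp add: power_mult)
      then have v2: "\<gamma> ^ 3 * w2 + deriv (E \<gamma>) w1 = z"
        by (simp only: geometric_potential_deriv[OF E that] T_def z_def)
          (simp add: algebra_simps power2_eq_square power3_eq_cube)
      have "z ^ m = (w1^2) ^ m + \<gamma>^2 * T * p (\<gamma>, w1, w2)"
        using p(2)[of "(\<gamma>, w1, w2)"] T by (simp add: z_def)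
      then have y: "w1 * z ^ m - T = \<gamma> * y"
        by (simp add: y_def Y'_def T) (simp add: T_def algebra_simps power2_eq_square)
      have "w1 / \<gamma> * z ^ m - 1 / \<gamma> * T = (w1 * z ^ m - T) / \<gamma>" by (simp add: diff_divide_distrib)
      also have "\<dots> = y" using that by (simp add: y)
      finally have Y: "w1 / \<gamma> * z ^ m - 1 / \<gamma> * T = y" .
      \<comment> \<open>Substituting \<open>z = w1^2 + \<gamma>^2 * T\<close> for one factor exposes
        \<open>w1 * z ^ m - T\<close>, already known to be divisible by \<gamma>.\<close>
      have "1 / \<gamma> * (z * z ^ m) - w1 / \<gamma> * T = (w1 * (w1 * z ^ m - T) + \<gamma>^2 * T * z ^ m) / \<gamma>"
        by (simp add: z_def algebra_simps add_divide_distrib diff_divide_distrib power2_eq_square)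
      also have "\<dots> = w1 * y + \<gamma> * T * z ^ m"
        using that by (simp add: y add_divide_distrib power2_eq_square)
      finally have X: "1 / \<gamma> * (z * z ^ m) - w1 / \<gamma> * T = w1 * y + \<gamma> * T * z ^ m" .
      have "(1 / \<gamma>)^2 * z - (w1 / \<gamma>)^2 = T"
        using that by (simp add: z_def field_simps)
      then show ?thesis
        unfolding P_def P'_def v2 Let_def fst_conv snd_conv T Z by (simp only: X Y y_def)
    qed
    show "singular_point ?F (0, 0, 0, 0)"
      by (auto simp: singular_point_def intro!: DERIV_imp_deriv derivative_eq_intros)
    show "P (\<beta>, v1, v2) = (0, 0, 0, 0) \<Longrightarrow> v1 = 0 \<and> v2 = 0" for \<beta> v1 v2
      by (auto simp: P_def Let_def)
    show "P' (0, w1, w2) = (0, 0, 0, 0) \<Longrightarrow> w1 = 0 \<and> w2 = 0" for w1 w2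
      by (simp add: P'_def Y'_def Z'_def)
    show "?F (P q) = 0" for q
      unfolding P_def Let_def case_prod_conv pow by algebra
    show "P (- (snd (snd (snd q)) * fst (snd q) + fst (snd (snd q)) ^ m * fst q) / h q,
        - (snd (snd (snd q)) * fst q + fst (snd (snd q)) * fst (snd (snd q)) ^ m * fst (snd q)) / h q,
        fst (snd (snd q)) * h q / h q) = q"
      if "?F q = 0" "h q \<noteq> 0" for q
    proof -
      obtain X Y Z T where q: "q = (X, Y, Z, T)" by (metis prod_cases4)
      define M where "M = Z ^ m"
      define D where "D = h q"
      have D: "D \<noteq> 0" "D = T^2 - Z * M^2" using that(2) by (simp_all add: q D_def M_def h_def)
      have F: "X^2 - Y^2 * Z - T * (Z * M^2 - T^2) = 0" using that(1) by (simp only: q case_prod_conv pow M_def)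
      define b where "b = - (T * Y + M * X) / D"
      define v where "v = - (T * X + Z * M * Y) / D"
      have bv: "b * D = - (T * Y + M * X)" "v * D = - (T * X + Z * M * Y)"
        using D(1) by (simp_all add: b_def v_def)
      \<comment> \<open>Multiplying by powers of the nonzero \<open>D\<close> turns each coordinate
        into a polynomial identity modulo the equation.\<close>
      have "(b^2 * Z - v^2 - T) * D^2 = (b * D)^2 * Z - (v * D)^2 - T * D^2" by algebra
      also have "\<dots> = 0" unfolding bv using F D(2) by algebra
      finally have T: "b^2 * Z - v^2 = T" using D(1) by simp
      have "(v * M - b * T - Y) * D = 0" using bv D(2) by algebra
      then have Y: "v * M - b * T = Y" using D(1) by simp
      have "(b * (Z * M) - v * T - X) * D = 0" using bv D(2) by algebra
      then have X: "b * (Z * M) - v * T = X" using D(1) by simp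
      have "P (b, v, Z) = q"
        by (simp add: P_def Let_def T M_def[symmetric] Y X q)
      then show ?thesis
        using D(1) by (simp only: b_def v_def M_def D_def q fst_conv snd_conv
            nonzero_mult_div_cancel_right simp_thms)
    qed
    show "\<exists>H. poly_in coords4 H \<and> (\<forall>q. G q = H q * ?F q)"
      if G: "poly_in coords4 G" "\<And>q. ?F q = 0 \<Longrightarrow> h q \<noteq> 0 \<Longrightarrow> G q = 0" for G
    proof (rule square_generates[where h = h, OF _ _ _ _ _ _ G])
      let ?r = "\<lambda>q :: cpx4. fst (snd q) ^ 2 * fst (snd (snd q))
        + snd (snd (snd q)) * (fst (snd (snd q)) ^ (2 * m + 1) - snd (snd (snd q)) ^ 2)"
      let ?n = "\<lambda>q :: cpx4. ?r q * (snd (snd (snd q)) ^ 2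
        - fst (snd (snd q)) * (fst (snd (snd q)) ^ m) ^ 2)"
      show "poly_in coords_YZT ?r" "poly_in coords_YZT ?n"
        by (intro poly_in_intros poly_in_diff poly_in_power poly_in.coord; simp)+
      show "?n (0, 0, 0, 1) \<noteq> 0" by simp
    qed (simp_all add: h_def split: prod.splits)
    show "- (snd (snd (snd (P (\<beta>, v1, v2)))) * fst (snd (P (\<beta>, v1, v2)))
          + fst (snd (snd (P (\<beta>, v1, v2)))) ^ m * fst (P (\<beta>, v1, v2))) = \<beta> * h (P (\<beta>, v1, v2)) \<and>
        - (snd (snd (snd (P (\<beta>, v1, v2)))) * fst (P (\<beta>, v1, v2))
          + fst (snd (snd (P (\<beta>, v1, v2)))) * fst (snd (snd (P (\<beta>, v1, v2)))) ^ m
            * fst (snd (P (\<beta>, v1, v2)))) = v1 * h (P (\<beta>, v1, v2)) \<and>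
        fst (snd (snd (P (\<beta>, v1, v2)))) * h (P (\<beta>, v1, v2)) = v2 * h (P (\<beta>, v1, v2))" for \<beta> v1 v2
      unfolding P_def h_def Let_def fst_conv snd_conv by algebra
  qed (use h in \<open>auto simp: P_def P'_def T'_def Y'_def Z'_def h_def Let_def
        intro!: poly_in_rules\<close>)
qed

text \<open>The global functions satisfy the linear system
  \<open>Y \<beta> - T v\<^sub>1 - Z v\<^sub>2 = 0\<close>, \<open>- Z^2 \<beta> + Y v\<^sub>1 - T v\<^sub>2 = 0\<close>, \<open>- Z T \<beta> - Z^2 v\<^sub>1 + Y v\<^sub>2 = X\<close>
  whose determinant \<open>Y^3 - 3 T Y Z^2 - T^3 Z - Z^5\<close> equals \<open>X^2\<close>: this is the equation \<open>F = 0\<close>, and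
  Cramer's rule gives the inverse with denominator \<open>X\<close>.\<close>

lemma blows_down_to_E7:
  assumes E: "geometric_potential E (\<lambda>\<gamma> w. \<gamma> powi (-1) * w^2 + \<gamma> * w^3)"
  shows "blows_down_to E (\<lambda>(X, Y, Z, T). X^2 - Y^3 + Z^5 + 3 * T * Y * Z^2 + T^3 * Z)"
proof -
  define P :: "cpx3 \<Rightarrow> cpx4" where
    "P = (\<lambda>q. let \<beta> = fst q; v1 = fst (snd q); v2 = snd (snd q); Z = \<beta> * v2 - v1^2;
       T = v1 * v2 - \<beta>^2 * Z; Y = v2^2 - \<beta> * v1 * Z
       in (v2 * Y - \<beta> * Z * T - v1 * Z^2, Y, Z, T))"
  \<comment> \<open>Substitute \<open>v2 = \<gamma> * Z + w1^2 / \<gamma>\<close>; the negative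
    powers of \<gamma> in \<open>T\<close>, \<open>Y\<close> and \<open>X\<close> cancel through
    \<open>Z - w1^3 = \<gamma>^2 * w2\<close>.\<close>
  define P' :: "cpx3 \<Rightarrow> cpx4" where
    "P' = (\<lambda>q. let \<gamma> = fst q; w1 = fst (snd q); w2 = snd (snd q); Z = \<gamma>^2 * w2 + w1^3;
       T = w1 * Z - w2; Y = \<gamma>^2 * Z^2 + 2 * Z * w1^2 - w1 * w2
       in (\<gamma> * Z * Y + \<gamma> * T^2, Y, Z, T))"
  let ?F = "\<lambda>(X, Y, Z, T). X^2 - Y^3 + Z^5 + 3 * T * Y * Z^2 + T^3 * Z"
  show ?thesis
  \<comment> \<open>\<open>a\<close>, \<open>b\<close>, \<open>c\<close> are the cofactors of the
    last row of the system: Cramer's rule gives \<open>X\<close> times each over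
    \<open>X^2\<close>.\<close>
  proof (rule blows_down_toI[where P = P and P' = P' and orig = "(0, 0, 0, 0)" and v = "(0, 0, 1)"
        and h = fst
        and a = "\<lambda>q. snd (snd (snd q)) ^ 2 + fst (snd (snd q)) * fst (snd q)"
        and b = "\<lambda>q. fst (snd (snd q)) ^ 3 + fst (snd q) * snd (snd (snd q))"
        and c = "\<lambda>q. fst (snd q) ^ 2 - snd (snd (snd q)) * fst (snd (snd q)) ^ 2"])
    show "poly_in coords4 ?F"
      unfolding case_prod_unfold by (intro poly_in_rules)
    show "poly_in coords3 (c \<circ> P)" if "c \<in> coords4" for c
      using that by (auto simp: coords4_iff P_def Let_def o_def intro!: poly_in_rules)
    show "poly_in coords3 (c \<circ> P')" if "c \<in> coords4" for c
      using that by (auto simp: coords4_iff P'_def Let_def o_def intro!: poly_in_rules)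
    show "P' (\<gamma>, w1, w2) = P (1 / \<gamma>, w1 / \<gamma>, \<gamma> ^ 3 * w2 + deriv (E \<gamma>) w1)" if "\<gamma> \<noteq> 0" for \<gamma> w1 w2
    proof -
      \<comment> \<open>Naming the inverse makes all identities polynomial modulo
        \<open>b * \<gamma> = 1\<close>.\<close>
      define b where "b = 1 / \<gamma>"
      have b: "b * \<gamma> = 1" "\<gamma> powi (-1) = b" "w1 / \<gamma> = b * w1"
        using that by (simp_all add: b_def power_int_minus divide_inverse)
      define Z where "Z = \<gamma>^2 * w2 + w1^3"
      define T where "T = w1 * Z - w2"
      define Y where "Y = \<gamma>^2 * Z^2 + 2 * Z * w1^2 - w1 * w2"
      define v2 where "v2 = \<gamma> * Z + b * w1^2"
      have v2: "\<gamma> ^ 3 * w2 + deriv (E \<gamma>) w1 = v2"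
        unfolding geometric_potential_deriv[OF E that] Z_def v2_def b by algebra
      have Z: "b * v2 - (b * w1)^2 = Z" using b(1) unfolding v2_def by algebra
      have T: "b * w1 * v2 - b^2 * Z = T" using b(1) unfolding v2_def T_def Z_def by algebra
      have Y: "v2^2 - b * (b * w1) * Z = Y" using b(1) unfolding v2_def Y_def Z_def by algebra
      have "v2 * Y - b * Z * T - b * w1 * Z^2 = \<gamma> * Z * Y + \<gamma> * T^2"
        using b(1) unfolding v2_def Y_def T_def Z_def by algebra
      then show ?thesis
        unfolding P_def P'_def v2 Let_def fst_conv snd_conv b b_def[symmetric] Z T Y
        by (simp only: Z_def[symmetric] T_def[symmetric] Y_def[symmetric])
    qed
    show "singular_point ?F (0, 0, 0, 0)"
      by (auto simp: singular_point_def intro!: DERIV_imp_deriv derivative_eq_intros)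
    show "P (\<beta>, v1, v2) = (0, 0, 0, 0) \<Longrightarrow> v1 = 0 \<and> v2 = 0" for \<beta> v1 v2
      by (auto simp: P_def Let_def)
    show "P' (0, w1, w2) = (0, 0, 0, 0) \<Longrightarrow> w1 = 0 \<and> w2 = 0" for w1 w2
      by (auto simp: P'_def Let_def)
    show "?F (P q) = 0" for q
      unfolding P_def Let_def case_prod_conv by algebra
    show "P ((snd (snd (snd q)) ^ 2 + fst (snd (snd q)) * fst (snd q)) / fst q,
        (fst (snd (snd q)) ^ 3 + fst (snd q) * snd (snd (snd q))) / fst q,
        (fst (snd q) ^ 2 - snd (snd (snd q)) * fst (snd (snd q)) ^ 2) / fst q) = q"
      if "?F q = 0" "fst q \<noteq> 0" for q
    proof -
      obtain X Y Z T where q: "q = (X, Y, Z, T)" by (metis prod_cases4)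
      have X0: "X \<noteq> 0" and F: "X^2 = Y^3 - Z^5 - 3 * T * Y * Z^2 - T^3 * Z"
        using that by (auto simp: q algebra_simps)
      define b where "b = (T^2 + Z * Y) / X"
      define v1 where "v1 = (Z^3 + Y * T) / X"
      define v2 where "v2 = (Y^2 - T * Z^2) / X"
      have bv: "b * X = T^2 + Z * Y" "v1 * X = Z^3 + Y * T" "v2 * X = Y^2 - T * Z^2"
        using X0 by (simp_all add: b_def v1_def v2_def)
      have "(b * v2 - v1^2 - Z) * X^2 = (b * X) * (v2 * X) - (v1 * X)^2 - Z * X^2" by algebra
      also have "\<dots> = 0" unfolding bv F by algebra
      finally have Z: "b * v2 - v1^2 = Z" using X0 by simp
      have "(v1 * v2 - b^2 * Z - T) * X^2 = (v1 * X) * (v2 * X) - (b * X)^2 * Z - T * X^2" by algebra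
      also have "\<dots> = 0" unfolding bv F by algebra
      finally have T: "v1 * v2 - b^2 * Z = T" using X0 by simp
      have "(v2^2 - b * v1 * Z - Y) * X^2 = (v2 * X)^2 - (b * X) * (v1 * X) * Z - Y * X^2" by algebra
      also have "\<dots> = 0" unfolding bv F by algebra
      finally have Y: "v2^2 - b * v1 * Z = Y" using X0 by simp
      have "(v2 * Y - b * Z * T - v1 * Z^2 - X) * X
          = (v2 * X) * Y - (b * X) * Z * T - (v1 * X) * Z^2 - X^2" by algebra
      also have "\<dots> = 0" unfolding bv F by algebra
      finally have X: "v2 * Y - b * Z * T - v1 * Z^2 = X" using X0 by simp
      have "P (b, v1, v2) = q"
        by (simp add: P_def Let_def Z T Y X q)
      then show ?thesis by (simp add: b_def v1_def v2_def q)
    qed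
    show "\<exists>H. poly_in coords4 H \<and> (\<forall>q. G q = H q * ?F q)"
      if G: "poly_in coords4 G" "\<And>q. ?F q = 0 \<Longrightarrow> fst q \<noteq> 0 \<Longrightarrow> G q = 0" for G
    \<comment> \<open>The denominator is \<open>X\<close>, nonzero at both roots once
      \<open>?r\<close> is, so \<open>?r\<close> itself serves as \<open>n\<close>.\<close>
    proof (rule square_generates[OF _ _ _ _ _ _ G])
      let ?r = "\<lambda>q :: cpx4. fst (snd q) ^ 3 - fst (snd (snd q)) ^ 5
        - 3 * snd (snd (snd q)) * fst (snd q) * fst (snd (snd q)) ^ 2
        - snd (snd (snd q)) ^ 3 * fst (snd (snd q))"
      show "poly_in coords_YZT ?r" "poly_in coords_YZT ?r"
        by (intro poly_in_intros poly_in_diff poly_in_power poly_in.coord; simp)+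
      show "?r (0, 1, 0, 0) \<noteq> 0" by simp
    qed (simp_all split: prod.splits)
    show "snd (snd (snd (P (\<beta>, v1, v2)))) ^ 2 + fst (snd (snd (P (\<beta>, v1, v2)))) * fst (snd (P (\<beta>, v1, v2)))
          = \<beta> * fst (P (\<beta>, v1, v2)) \<and>
        fst (snd (snd (P (\<beta>, v1, v2)))) ^ 3 + fst (snd (P (\<beta>, v1, v2))) * snd (snd (snd (P (\<beta>, v1, v2))))
          = v1 * fst (P (\<beta>, v1, v2)) \<and>
        fst (snd (P (\<beta>, v1, v2))) ^ 2
          - snd (snd (snd (P (\<beta>, v1, v2)))) * fst (snd (snd (P (\<beta>, v1, v2)))) ^ 2
          = v2 * fst (P (\<beta>, v1, v2))" for \<beta> v1 v2
      unfolding P_def Let_def fst_conv snd_conv by (intro conjI; algebra)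
  qed (auto simp: P_def P'_def Let_def intro!: poly_in_rules)
qed

theorem theorem2:
  fixes k :: nat
  assumes "k \<ge> 1"
  shows
    "(\<forall>E. geometric_potential E (\<lambda>\<gamma> w. \<gamma>^2 * w^k + w) \<longrightarrow>
       (\<forall>x y. matrix_potential E x y = 1 / of_nat (k + 1) * x^(k + 1) + 1 / 2 * y^2) \<and>
       blows_down_to E (\<lambda>(X, Y, Z, T). X * Y - T * (Z^k - T))) \<and>
     (\<forall>E. geometric_potential E (\<lambda>\<gamma> w. \<gamma>^2 * w^k + w^2) \<longrightarrow>
       (\<forall>x y. matrix_potential E x y = 1 / of_nat (k + 1) * x^(k + 1) + x * y^2) \<and>
       (even k \<longrightarrow>
         blows_down_to E (\<lambda>(X, Y, Z, T). X^2 - Y^2 * Z + T * (Z^(k div 2) - T)^2)) \<and>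
       (odd k \<longrightarrow>
         blows_down_to E (\<lambda>(X, Y, Z, T). X^2 - Y^2 * Z - T * (Z^k - T^2)))) \<and>
     (\<forall>E. geometric_potential E (\<lambda>\<gamma> w. \<gamma> powi (-1) * w^2 + \<gamma> * w^3) \<longrightarrow>
       (\<forall>x y. matrix_potential E x y = 1 / 3 * y^3 + y * x^3) \<and>
       blows_down_to E (\<lambda>(X, Y, Z, T). X^2 - Y^3 + Z^5 + 3 * T * Y * Z^2 + T^3 * Z))"
proof (intro conjI allI impI)
  fix E assume E: "geometric_potential E (\<lambda>\<gamma> w. \<gamma>^2 * w^k + w)"
  show "matrix_potential E x y = 1 / of_nat (k + 1) * x^(k + 1) + 1 / 2 * y^2" for x y
    by (rule matrix_potential_A[OF E])
  show "blows_down_to E (\<lambda>(X, Y, Z, T). X * Y - T * (Z^k - T))"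
    by (rule blows_down_to_A[OF assms E])
next
  fix E assume E: "geometric_potential E (\<lambda>\<gamma> w. \<gamma>^2 * w^k + w^2)"
  show "matrix_potential E x y = 1 / of_nat (k + 1) * x^(k + 1) + x * y^2" for x y
    by (rule matrix_potential_D[OF E])
  show "blows_down_to E (\<lambda>(X, Y, Z, T). X^2 - Y^2 * Z + T * (Z^(k div 2) - T)^2)" if "even k"
  proof -
    from that have k: "k = 2 * (k div 2)" by simp
    have "k div 2 \<ge> 1" using that assms by presburger
    moreover have "geometric_potential E (\<lambda>\<gamma> w. \<gamma>^2 * w^(2 * (k div 2)) + w^2)"
      using E unfolding k[symmetric] .
    ultimately show ?thesis by (rule blows_down_to_D_even)
  qed
  show "blows_down_to E (\<lambda>(X, Y, Z, T). X^2 - Y^2 * Z - T * (Z^k - T^2))" if "odd k"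
  proof -
    from that obtain m where k: "k = 2 * m + 1" by (elim oddE)
    show ?thesis using blows_down_to_D_odd[of E m] E unfolding k .
  qed
next
  fix E assume E: "geometric_potential E (\<lambda>\<gamma> w. \<gamma> powi (-1) * w^2 + \<gamma> * w^3)"
  show "matrix_potential E x y = 1 / 3 * y^3 + y * x^3" for x y
    by (rule matrix_potential_E7[OF E])
  show "blows_down_to E (\<lambda>(X, Y, Z, T). X^2 - Y^3 + Z^5 + 3 * T * Y * Z^2 + T^3 * Z)"
    by (rule blows_down_to_E7[OF E])
qed

end
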